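(* Let $\Lambda$ be a recursive $\varepsilon$-number, and let $\textbf{TSC}$ and $\mathcal{H}$ be as in the context. For all $\varphi,\psi\in\mathbb{F}$: the sequent $\varphi\vdash\psi$ is derivable in $\textbf{TSC}$ if and only if for every $x\in H$, $\mathcal{H},x\Vdash\varphi$ implies $\mathcal{H},x\Vdash\psi$.
   Context: Fix a recursive ordinal $\Lambda$ that is an $\varepsilon$-number ($\omega^\Lambda=\Lambda$). Formulas: $\mathbb{F}$ is the smallest set containing $\top$, closed under $\wedge$, and such that if $\varphi\in\mathbb{F}$, $n<\omega$, $\alpha<\Lambda$ then $\langle n^\alpha\rangle\varphi\in\mathbb{F}$; by convention $\langle n^0\rangle\varphi$ is identified with $\varphi$. Hyper-exponentials: $e^0$ is the identity, $e^1(\alpha)=-1+\omega^\alpha$ (write $e=e^1$), $e^{n+m}=e^n\circ e^m$. Monomial normal forms ${\sf MNF}$: $\top\in{\sf MNF}$; $\langle n^\alpha\rangle\top\in{\sf MNF}$ for $n<\omega$, $\alpha<\Lambda$; and if $\langle n_0^{\alpha_0}\rangle\top\wedge\dots\wedge\langle n_k^{\alpha_k}\rangle\top\in{\sf MNF}$, $n<n_0$, and $\alpha=e^{n_0-n}(\alpha_0)\cdot(2+\delta)$ for some $\delta<\Lambda$, then $\langle n^\alpha\rangle\top\wedge\langle n_0^{\alpha_0}\rangle\top\wedge\dots\wedge\langle n_k^{\alpha_k}\rangle\top\in{\sf MNF}$. $\textbf{TSC}$ (Turing Schmerl Calculus) derives sequents $\varphi\vdash\psi$ ($\varphi,\psi\in\mathbb{F}$);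 $\varphi\equiv\psi$ means both $\varphi\vdash\psi$ and $\psi\vdash\varphi$. Axioms: (1) $\varphi\vdash\varphi$, $\varphi\vdash\top$; (2) $\varphi\wedge\psi\vdash\varphi$, $\varphi\wedge\psi\vdash\psi$; (3) $\langle n^\alpha\rangle\varphi\vdash\langle n^\beta\rangle\varphi$ for $\beta<\alpha$; (4) $\langle n^{\beta+\alpha}\rangle\varphi\equiv\langle n^\alpha\rangle\langle n^\beta\rangle\varphi$; (5) $\langle (n+m)^\alpha\rangle\varphi\vdash\langle n^{e^m(\alpha)}\rangle\varphi$; (6) $\langle n^\alpha\rangle(\langle n_0^{\alpha_0}\rangle\top\wedge\psi)\equiv\langle n^{e^{n_0-n}(\alpha_0)\cdot(1+\alpha)}\rangle\top\wedge\langle n_0^{\alpha_0}\rangle\top\wedge\psi$ for $n<n_0$ and $\langle n_0^{\alpha_0}\rangle\top\wedge\psi\in{\sf MNF}$. Rules: (i) from $\varphi\vdash\psi$ and $\varphi\vdash\chi$ infer $\varphi\vdash\psi\wedge\chi$; (ii) from $\varphi\vdash\psi$ and $\psi\vdash\chi$ infer $\varphi\vdash\chi$; (iii) from $\varphi\vdash\psi$ infer $\langle n^\alpha\rangle\varphi\vdash\langle n^\alpha\rangle\psi$; (iv) from $\varphi\vdash\psi$ infer $\langle n^\alpha\rangle\varphi\wedge\langle m^{\beta+1}\rangle\psi\vdash\langle n^\alpha\rangle(\varphi\wedge\langle m^{\beta+1}\rangle\psi)$ for $n>m$. The model $\mathcal{H}$: ordinal logarithm $\ell(0)=0$, $\ell(\alpha+\omega^\beta)=\beta$;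 an $\ell$-sequence is an $\omega$-sequence of ordinals $x$ with $x_{i+1}\le\ell(x_i)$; $H$ is the set of $\ell$-sequences with all entries $<\Lambda$ and some entry equal to $0$. For $n<\omega$, $xS_ny$ iff $x_m>y_m$ for all $m\le n$ and $x_i\ge y_i$ for all $i>n$. $xS_n^0y$ iff $x=y$; $xS_n^{1+\alpha}y$ iff for every $\beta<1+\alpha$ there is $z\in H$ with $xS_nz$ and $zS_n^\beta y$. Forcing: $x\Vdash\top$ always; $x\Vdash\varphi\wedge\psi$ iff both; $x\Vdash\langle n^\alpha\rangle\varphi$ iff there is $y\in H$ with $xS_n^\alpha y$ and $y\Vdash\varphi$.
   Formalization: Monomials in MNF are required to have nonzero exponents: with α₀=0 allowed, axiom (6) would derive ⊤ ⊢ ⟨0^1⟩⊤, which fails at the zero sequence. In axiom (6) ψ may also be absent. *)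

theory Defs
  imports Main "HOL-Library.Countable_Set"
begin

text \<open>The ordinals below the fixed ordinal Lambda are represented by the elements
of a well-ordered type 'o (whose order type is Lambda).  The standard ordinal
operations are defined intrinsically by transfinite recursion on 'o.\<close>

definition ozero :: "'o::wellorder" where
  "ozero = (LEAST x. True)"

definition osuc :: "'o::wellorder \<Rightarrow> 'o" where
  "osuc a = (LEAST b. a < b)"

definition oone :: "'o::wellorder" where
  "oone = osuc ozero"

definition otwo :: "'o::wellorder" where
  "otwo = osuc oone"

definition oomega :: "'o::wellorder" where
  "oomega = (LEAST c. ozero < c \<and> (\<forall>d<c. osuc d < c))"

definition oadd :: "'o::wellorder \<Rightarrow> 'o \<Rightarrow> 'o" where
  "oadd a = wfrec {(x, y). x < y} (\<lambda>F b. LEAST c. a \<le> c \<and> (\<forall>b'<b. F b' < c))"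

definition omul :: "'o::wellorder \<Rightarrow> 'o \<Rightarrow> 'o" where
  "omul a = wfrec {(x, y). x < y} (\<lambda>F b. LEAST c. \<forall>b'<b. oadd (F b') a \<le> c)"

definition oexpw :: "'o::wellorder \<Rightarrow> 'o" where
  "oexpw = wfrec {(x, y). x < y} (\<lambda>F b. LEAST c. oone \<le> c \<and> (\<forall>b'<b. omul (F b') oomega \<le> c))"

definition ominus1 :: "'o::wellorder \<Rightarrow> 'o" where
  "ominus1 b = (THE g. oadd oone g = b)"

definition hexp :: "'o::wellorder \<Rightarrow> 'o" where
  "hexp a = ominus1 (oexpw a)"

abbreviation hexpn :: "nat \<Rightarrow> 'o::wellorder \<Rightarrow> 'o" where
  "hexpn n \<equiv> hexp ^^ n"

definition ologd :: "'o::wellorder \<Rightarrow> 'o" where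
  "ologd a = (if a = ozero then ozero else (THE b. \<exists>g. a = oadd g (oexpw b)))"

definition ord_rel :: "('o::wellorder) rel" where
  "ord_rel = {(x, y). x \<le> y}"

text \<open>The standard well-order of order type omega^Lambda: finitely supported
functions 'o => nat, compared at the largest position where they differ.\<close>
definition fin_supp :: "('o \<Rightarrow> nat) set" where
  "fin_supp = {f. finite {x. f x \<noteq> 0}}"

definition omega_pow_rel :: "('o::wellorder \<Rightarrow> nat) rel" where
  "omega_pow_rel = {(f, g). f \<in> fin_supp \<and> g \<in> fin_supp \<and>
      (f = g \<or> f (Max {x. f x \<noteq> g x}) < g (Max {x. f x \<noteq> g x}))}"

definition epsilon_number_type :: "'o::wellorder itself \<Rightarrow> bool" where
  "epsilon_number_type (T :: 'o itself) \<longleftrightarrow> ((omega_pow_rel :: ('o \<Rightarrow> nat) rel), (ord_rel :: 'o rel)) \<in> BNF_Wellorder_Constructions.ordIso"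

datatype 'o fml = Top | Conj "'o fml" "'o fml" | Dia nat 'o "'o fml"

text \<open>Convention: <n^0>phi is identified with phi.  We realise the identification
by working with formulas containing no <n^0> (wff) and the smart constructor dia.\<close>
fun wff :: "'o::wellorder fml \<Rightarrow> bool" where
  "wff Top = True"
| "wff (Conj a b) = (wff a \<and> wff b)"
| "wff (Dia n a f) = (a \<noteq> ozero \<and> wff f)"

definition dia :: "nat \<Rightarrow> 'o::wellorder \<Rightarrow> 'o fml \<Rightarrow> 'o fml" where
  "dia n a f = (if a = ozero then f else Dia n a f)"

fun mono_conj :: "(nat \<times> 'o::wellorder) list \<Rightarrow> 'o fml" where
  "mono_conj [] = Top"
| "mono_conj [(n, a)] = dia n a Top"
| "mono_conj ((n, a) # xs) = Conj (dia n a Top) (mono_conj xs)"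

inductive mnf_list :: "(nat \<times> 'o::wellorder) list \<Rightarrow> bool" where
  mnf_nil: "mnf_list []"
| mnf_single: "ozero < a \<Longrightarrow> mnf_list [(n, a)]"
| mnf_cons: "mnf_list ((n0, a0) # xs) \<Longrightarrow> n < n0 \<Longrightarrow>
     a = omul (hexpn (n0 - n) a0) (oadd otwo d) \<Longrightarrow> mnf_list ((n, a) # (n0, a0) # xs)"

definition MNF :: "'o::wellorder fml set" where
  "MNF = {mono_conj xs | xs. mnf_list xs}"

inductive tsc :: "'o::wellorder fml \<Rightarrow> 'o fml \<Rightarrow> bool" (infix \<open>\<turnstile>\<^sub>T\<close> 40) where
  ax_refl: "wff \<phi> \<Longrightarrow> \<phi> \<turnstile>\<^sub>T \<phi>"
| ax_top: "wff \<phi> \<Longrightarrow> \<phi> \<turnstile>\<^sub>T Top"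
| ax_conjL: "wff \<phi> \<Longrightarrow> wff \<psi> \<Longrightarrow> Conj \<phi> \<psi> \<turnstile>\<^sub>T \<phi>"
| ax_conjR: "wff \<phi> \<Longrightarrow> wff \<psi> \<Longrightarrow> Conj \<phi> \<psi> \<turnstile>\<^sub>T \<psi>"
| ax_mono: "wff \<phi> \<Longrightarrow> \<beta> < \<alpha> \<Longrightarrow> dia n \<alpha> \<phi> \<turnstile>\<^sub>T dia n \<beta> \<phi>"
| ax_add1: "wff \<phi> \<Longrightarrow> dia n (oadd \<beta> \<alpha>) \<phi> \<turnstile>\<^sub>T dia n \<alpha> (dia n \<beta> \<phi>)"
| ax_add2: "wff \<phi> \<Longrightarrow> dia n \<alpha> (dia n \<beta> \<phi>) \<turnstile>\<^sub>T dia n (oadd \<beta> \<alpha>) \<phi>"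
| ax_red: "wff \<phi> \<Longrightarrow> dia (n + m) \<alpha> \<phi> \<turnstile>\<^sub>T dia n (hexpn m \<alpha>) \<phi>"
| ax_mnf1: "mnf_list ((n0, \<alpha>0) # xs) \<Longrightarrow> n < n0 \<Longrightarrow>
     dia n \<alpha> (mono_conj ((n0, \<alpha>0) # xs)) \<turnstile>\<^sub>T
     mono_conj ((n, omul (hexpn (n0 - n) \<alpha>0) (oadd oone \<alpha>)) # (n0, \<alpha>0) # xs)"
| ax_mnf2: "mnf_list ((n0, \<alpha>0) # xs) \<Longrightarrow> n < n0 \<Longrightarrow>
     mono_conj ((n, omul (hexpn (n0 - n) \<alpha>0) (oadd oone \<alpha>)) # (n0, \<alpha>0) # xs)
     \<turnstile>\<^sub>T dia n \<alpha> (mono_conj ((n0, \<alpha>0) # xs))"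
| r_conj: "\<phi> \<turnstile>\<^sub>T \<psi> \<Longrightarrow> \<phi> \<turnstile>\<^sub>T \<chi> \<Longrightarrow> \<phi> \<turnstile>\<^sub>T Conj \<psi> \<chi>"
| r_cut: "\<phi> \<turnstile>\<^sub>T \<psi> \<Longrightarrow> \<psi> \<turnstile>\<^sub>T \<chi> \<Longrightarrow> \<phi> \<turnstile>\<^sub>T \<chi>"
| r_nec: "\<phi> \<turnstile>\<^sub>T \<psi> \<Longrightarrow> dia n \<alpha> \<phi> \<turnstile>\<^sub>T dia n \<alpha> \<psi>"
| r_mix: "\<phi> \<turnstile>\<^sub>T \<psi> \<Longrightarrow> m < n \<Longrightarrow>
     Conj (dia n \<alpha> \<phi>) (dia m (oadd \<beta> oone) \<psi>) \<turnstile>\<^sub>T dia n \<alpha> (Conj \<phi> (dia m (oadd \<beta> oone) \<psi>))"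

definition ell_seq :: "(nat \<Rightarrow> 'o::wellorder) \<Rightarrow> bool" where
  "ell_seq x \<longleftrightarrow> (\<forall>i. x (Suc i) \<le> ologd (x i))"

definition Hset :: "(nat \<Rightarrow> 'o::wellorder) set" where
  "Hset = {x. ell_seq x \<and> (\<exists>i. x i = ozero)}"

definition Srel :: "nat \<Rightarrow> (nat \<Rightarrow> 'o::wellorder) \<Rightarrow> (nat \<Rightarrow> 'o) \<Rightarrow> bool" where
  "Srel n x y \<longleftrightarrow> (\<forall>m\<le>n. y m < x m) \<and> (\<forall>i>n. y i \<le> x i)"

definition Srel_pow :: "nat \<Rightarrow> 'o::wellorder \<Rightarrow> (nat \<Rightarrow> 'o) \<Rightarrow> (nat \<Rightarrow> 'o) \<Rightarrow> bool" where
  "Srel_pow n = wfrec {(x, y). x < y}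
     (\<lambda>F g. if g = ozero then (\<lambda>x y. x = y)
            else (\<lambda>x y. \<forall>b<g. \<exists>z\<in>Hset. Srel n x z \<and> F b z y))"

fun forces :: "(nat \<Rightarrow> 'o::wellorder) \<Rightarrow> 'o fml \<Rightarrow> bool" where
  "forces x Top = True"
| "forces x (Conj a b) = (forces x a \<and> forces x b)"
| "forces x (Dia n a f) = (\<exists>y\<in>Hset. Srel_pow n a x y \<and> forces y f)"

end

theory Submission
  imports Defs
begin

text \<open>Both sides of the equivalence are governed by a single element of \<open>H\<close>. Every formula \<open>\<phi>\<close> has
a least point \<open>m\<close> in \<open>H\<close> forcing it, and it is forced exactly at the points coordinatewise above
\<open>m\<close>; moreover, \<open>\<chi> \<turnstile>\<^sub>T \<phi>\<close> holds if and only if \<open>\<chi>\<close> derives every atom \<open>\<langle>i\<^sup>m\<^sup>i\<rangle>\<top>\<close>. Both facts follow by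
the same induction, because conjunction and \<open>\<langle>n\<^sup>a\<rangle>\<close> act on \<open>m\<close> by the same operations on the two
sides. For \<open>a > 0\<close>, a point \<open>y\<close> is reached from \<open>x\<close> by \<open>a\<close> steps at level \<open>n\<close> exactly when
\<open>y\<^sub>n + \<omega>\<^sup>p \<cdot> a \<le> x\<^sub>n\<close> with \<open>p\<close> the entry of \<open>y\<close> at \<open>n + 1\<close>, \<open>y\<^sub>i < x\<^sub>i\<close> below \<open>n\<close> and \<open>y\<^sub>i \<le> x\<^sub>i\<close> above
\<open>n\<close>. Completeness is then immediate: if \<open>\<phi>\<close> entails \<open>\<psi>\<close>, the least point of \<open>\<psi>\<close> is below that of \<open>\<phi>\<close>,
and \<open>\<phi>\<close> derives all atoms of \<open>\<psi>\<close>.\<close>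

section \<open>The least element, recursion equations and elementary derivations\<close>

lemma ozero_le [simp]: "ozero \<le> (a::'o::wellorder)"
  unfolding ozero_def by (rule Least_le) simp

lemma not_less_ozero [simp]: "\<not> (a::'o::wellorder) < ozero"
  by (simp add: not_less)

lemma ozero_less_iff: "ozero < (a::'o::wellorder) \<longleftrightarrow> a \<noteq> ozero"
  by (simp add: order_less_le eq_commute)

lemma le_ozero_iff [simp]: "(a::'o::wellorder) \<le> ozero \<longleftrightarrow> a = ozero"
  by (metis ozero_le order_antisym order_refl)

lemma oadd_rec: "oadd a b = (LEAST c. a \<le> c \<and> (\<forall>b'<b. oadd a b' < c))"
  by (subst oadd_def, subst wfrec[OF wf], subst oadd_def[symmetric])
    (rule arg_cong[where f = Least], auto simp: cut_def)

lemma omul_rec: "omul a b = (LEAST c. \<forall>b'<b. oadd (omul a b') a \<le> c)"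
  by (subst omul_def, subst wfrec[OF wf], subst omul_def[symmetric])
    (rule arg_cong[where f = Least], auto simp: cut_def)

lemma oexpw_rec: "oexpw b = (LEAST c. oone \<le> c \<and> (\<forall>b'<b. omul (oexpw b') oomega \<le> c))"
  by (subst oexpw_def, subst wfrec[OF wf], subst oexpw_def[symmetric])
    (rule arg_cong[where f = Least], auto simp: cut_def)

lemma Srel_pow_zero [simp]: "Srel_pow n ozero x y \<longleftrightarrow> x = y"
  unfolding Srel_pow_def by (subst wfrec[OF wf]) simp

lemma Srel_pow_rec:
  "a \<noteq> ozero \<Longrightarrow> Srel_pow n a x y \<longleftrightarrow> (\<forall>b<a. \<exists>z\<in>Hset. Srel n x z \<and> Srel_pow n b z y)"
  by (subst Srel_pow_def, subst wfrec[OF wf], subst Srel_pow_def[symmetric])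
    (auto simp: cut_def)

lemma wff_dia [simp]: "wff (dia n a \<phi>) \<longleftrightarrow> wff \<phi>"
  by (simp add: dia_def)

lemma dia_zero [simp]: "dia n ozero \<phi> = \<phi>"
  by (simp add: dia_def)

lemma wff_mono_conj [simp]: "wff (mono_conj xs)"
  by (induction xs rule: mono_conj.induct) auto

lemma tsc_wff: "\<phi> \<turnstile>\<^sub>T \<psi> \<Longrightarrow> wff \<phi> \<and> wff \<psi>"
  by (induction rule: tsc.induct) simp_all

lemma tsc_Conj_iff: "\<chi> \<turnstile>\<^sub>T Conj \<phi> \<psi> \<longleftrightarrow> \<chi> \<turnstile>\<^sub>T \<phi> \<and> \<chi> \<turnstile>\<^sub>T \<psi>"
  using r_conj r_cut ax_conjL ax_conjR tsc_wff by (metis wff.simps(2))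

lemma tsc_le: "wff \<phi> \<Longrightarrow> b \<le> a \<Longrightarrow> dia n a \<phi> \<turnstile>\<^sub>T dia n b \<phi>"
  by (cases "b = a") (auto intro: ax_refl ax_mono)

lemma tsc_atom_le: "\<chi> \<turnstile>\<^sub>T dia n a Top \<Longrightarrow> b \<le> a \<Longrightarrow> \<chi> \<turnstile>\<^sub>T dia n b Top"
  using tsc_le[of Top b a n] r_cut by simp

lemma tsc_hexpn: "\<chi> \<turnstile>\<^sub>T dia (n + k) a \<phi> \<Longrightarrow> \<chi> \<turnstile>\<^sub>T dia n (hexpn k a) \<phi>"
  using ax_red r_cut tsc_wff by (metis wff_dia)

lemma tsc_hexp: "\<chi> \<turnstile>\<^sub>T dia (Suc n) a \<phi> \<Longrightarrow> \<chi> \<turnstile>\<^sub>T dia n (hexp a) \<phi>"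
  using tsc_hexpn[of \<chi> n 1 a] by simp

lemmas [trans] = r_cut

lemma tsc_equiv: "\<phi> \<turnstile>\<^sub>T \<psi> \<Longrightarrow> \<psi> \<turnstile>\<^sub>T \<phi> \<Longrightarrow> \<chi> \<turnstile>\<^sub>T \<phi> \<longleftrightarrow> \<chi> \<turnstile>\<^sub>T \<psi>"
  by (blast intro: r_cut)

lemma tsc_add_iff: "wff \<phi> \<Longrightarrow> \<chi> \<turnstile>\<^sub>T dia n a (dia n b \<phi>) \<longleftrightarrow> \<chi> \<turnstile>\<^sub>T dia n (oadd b a) \<phi>"
  by (intro tsc_equiv ax_add1 ax_add2)

text \<open>\<open>LEAST\<close> is unspecified when no bound exists, so the ordinal operations
  behave as intended only on a type closed under them. The assumption supplies all bounds needed
  below.\<close>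

locale epsilon_number =
  fixes T :: "'o::wellorder itself"
  assumes epsilon: "epsilon_number_type T"
begin

notation ozero (\<open>\<zero>\<close>)
notation oone (\<open>\<one>\<close>)
notation oadd (infixl \<open>\<oplus>\<close> 65)
notation omul (infixl \<open>\<odot>\<close> 70)

subsection \<open>Cantor normal forms\<close>

text \<open>Inverting the order isomorphism from omega^Lambda attaches to each element a finitely
  supported coefficient function.\<close>

lemma ex_cnf:
  "\<exists>cnf :: 'o \<Rightarrow> 'o \<Rightarrow> nat. (\<forall>a. finite {x. cnf a x \<noteq> 0}) \<and>
     (\<forall>f. finite {x. f x \<noteq> 0} \<longrightarrow> (\<exists>a. cnf a = f)) \<and>
     (\<forall>a b. a < b \<longleftrightarrow> (\<exists>x. cnf a x < cnf b x \<and> (\<forall>y>x. cnf a y = cnf b y)))"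
proof -
  let ?r = "omega_pow_rel :: ('o \<Rightarrow> nat) rel" and ?s = "ord_rel :: 'o rel"
  have field: "Field ?r = fin_supp" "Field ?s = UNIV"
    by (auto simp: Field_def omega_pow_rel_def ord_rel_def)
  obtain h where h: "iso ?r ?s h"
    using epsilon unfolding epsilon_number_type_def ordIso_def by blast
  then have bij: "bij_betw h fin_supp UNIV"
    and ord: "\<And>f g. f \<in> fin_supp \<Longrightarrow> g \<in> fin_supp \<Longrightarrow> (f, g) \<in> ?r \<longleftrightarrow> h f \<le> h g"
    unfolding iso_iff2 field by (auto simp: ord_rel_def)
  define cnf where "cnf = inv_into fin_supp h"
  have fin: "cnf a \<in> fin_supp" and hc: "h (cnf a) = a" for a
    using bij unfolding cnf_def bij_betw_def by (auto simp: inv_into_into f_inv_into_f)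
  have surj: "cnf (h f) = f" if "f \<in> fin_supp" for f
    using bij that unfolding cnf_def bij_betw_def by simp
  have lt: "a < b \<longleftrightarrow> (\<exists>x. cnf a x < cnf b x \<and> (\<forall>y>x. cnf a y = cnf b y))" (is "_ \<longleftrightarrow> ?R a b")
    for a b
  proof -
    have fwd: "?R a b" if "a < b" for a b
    proof -
      have ne: "cnf a \<noteq> cnf b" using that hc by (metis less_irrefl)
      let ?D = "{x. cnf a x \<noteq> cnf b x}"
      have "(cnf a, cnf b) \<in> ?r" using that ord[OF fin fin] hc by simp
      then have *: "cnf a (Max ?D) < cnf b (Max ?D)" using ne by (simp add: omega_pow_rel_def)
      have "?D \<subseteq> {x. cnf a x \<noteq> 0} \<union> {x. cnf b x \<noteq> 0}" by auto
      moreover have "finite ({x. cnf a x \<noteq> 0} \<union> {x. cnf b x \<noteq> 0})"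
        using fin[of a] fin[of b] unfolding fin_supp_def by blast
      ultimately have "finite ?D" by (rule finite_subset)
      then have "\<forall>y>Max ?D. cnf a y = cnf b y" using Max_ge leD by blast
      with * show ?thesis by blast
    qed
    \<comment> \<open>By totality the converse only needs that opposite witnesses exclude each
      other; they clash at the larger of the two positions.\<close>
    have "\<not> ?R b a" if "?R a b"
    proof
      assume "?R b a"
      with that obtain x y where x: "cnf a x < cnf b x" "\<forall>z>x. cnf a z = cnf b z"
        and y: "cnf b y < cnf a y" "\<forall>z>y. cnf b z = cnf a z" by blast
      then show False by (cases x y rule: linorder_cases) auto
    qed
    with fwd show ?thesis by (metis less_irrefl linorder_less_linear)
  qed
  show ?thesis
    using fin lt surj unfolding fin_supp_def by (intro exI[of _ cnf]) blast
qed

text \<open>To be read as the coefficient of omega^x in the Cantor normal form of a; later proofs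
  rely only on the three properties listed.\<close>

definition cnf :: "'o \<Rightarrow> 'o \<Rightarrow> nat" where
  "cnf = (SOME cnf. (\<forall>a. finite {x. cnf a x \<noteq> 0}) \<and>
     (\<forall>f. finite {x. f x \<noteq> 0} \<longrightarrow> (\<exists>a. cnf a = f)) \<and>
     (\<forall>a b. a < b \<longleftrightarrow> (\<exists>x. cnf a x < cnf b x \<and> (\<forall>y>x. cnf a y = cnf b y))))"

lemma finite_cnf: "finite {x. cnf a x \<noteq> 0}"
  and cnf_surj: "finite {x. f x \<noteq> 0} \<Longrightarrow> \<exists>a. cnf a = f"
  and less_cnf: "a < b \<longleftrightarrow> (\<exists>x. cnf a x < cnf b x \<and> (\<forall>y>x. cnf a y = cnf b y))"
  using someI_ex[OF ex_cnf] unfolding cnf_def[symmetric] by blast+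

lemma less_cnfI: "cnf a x < cnf b x \<Longrightarrow> (\<And>y. x < y \<Longrightarrow> cnf a y = cnf b y) \<Longrightarrow> a < b"
  using less_cnf by blast

lemma less_cnfE:
  assumes "a < b"
  obtains x where "cnf a x < cnf b x" "\<forall>y>x. cnf a y = cnf b y"
  using assms less_cnf by blast

definition of_cnf :: "('o \<Rightarrow> nat) \<Rightarrow> 'o" where
  "of_cnf f = (SOME a. cnf a = f)"

lemma cnf_of_cnf: "finite {x. f x \<noteq> 0} \<Longrightarrow> cnf (of_cnf f) = f"
  unfolding of_cnf_def by (rule someI_ex) (rule cnf_surj)

definition nsum :: "'o \<Rightarrow> 'o \<Rightarrow> 'o" where
  "nsum a b = of_cnf (\<lambda>x. cnf a x + cnf b x)"

lemma cnf_nsum: "cnf (nsum a b) x = cnf a x + cnf b x"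
proof -
  have "{x. cnf a x + cnf b x \<noteq> 0} = {x. cnf a x \<noteq> 0} \<union> {x. cnf b x \<noteq> 0}" by auto
  then have "finite {x. cnf a x + cnf b x \<noteq> 0}" using finite_cnf by (metis finite_UnI)
  then show ?thesis unfolding nsum_def by (simp add: cnf_of_cnf)
qed

lemma nsum_strict: "b < b' \<Longrightarrow> nsum a b < nsum a b'"
  by (erule less_cnfE) (auto intro: less_cnfI simp: cnf_nsum)

lemma le_nsum: "a \<le> nsum a b"
proof (rule ccontr)
  assume "\<not> a \<le> nsum a b"
  then obtain x where "cnf (nsum a b) x < cnf a x" by (meson less_cnfE not_le)
  then show False by (simp add: cnf_nsum)
qed

text \<open>Stands for omega^a, and serves as a bound before \<open>oexpw\<close> is known to behave
  well.\<close>

definition osingle :: "'o \<Rightarrow> 'o" where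
  "osingle a = of_cnf (\<lambda>x. if x = a then 1 else 0)"

lemma cnf_osingle: "cnf (osingle a) x = (if x = a then 1 else 0)"
  unfolding osingle_def by (subst cnf_of_cnf) auto

lemma less_osingle: "a < osingle b \<longleftrightarrow> (\<forall>y\<ge>b. cnf a y = 0)"
proof
  assume "a < osingle b"
  then obtain x where x: "cnf a x < cnf (osingle b) x" "\<forall>y>x. cnf a y = cnf (osingle b) y"
    by (rule less_cnfE)
  then show "\<forall>y\<ge>b. cnf a y = 0"
    by (metis cnf_osingle less_one not_less0 order_le_imp_less_or_eq order_less_irrefl)
qed (auto simp: cnf_osingle intro!: less_cnfI[of _ b])

lemma nsum_less_osingle: "a < osingle c \<Longrightarrow> b < osingle c \<Longrightarrow> nsum a b < osingle c"
  by (simp add: less_osingle cnf_nsum)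

lemma osingle_strict: "a < b \<Longrightarrow> osingle a < osingle b"
  unfolding less_osingle by (auto simp: cnf_osingle)

lemma less_nsum_osingle: "a < nsum a (osingle b)"
  by (rule less_cnfI[of _ b]) (auto simp: cnf_nsum cnf_osingle)

text \<open>Otherwise \<open>less_osingle\<close> would give every element a nonzero coefficient,
  yet the zero function is also the coefficient function of some element.\<close>

lemma osingle_ne_zero [simp]: "osingle a \<noteq> ozero"
proof
  assume "osingle a = ozero"
  then have "\<not> b < osingle a" for b by simp
  then have "\<exists>y\<ge>a. cnf b y \<noteq> 0" for b unfolding less_osingle by blast
  moreover obtain b where "cnf b = (\<lambda>_. 0)" using cnf_surj[of "\<lambda>_. 0"] by auto
  ultimately show False by metis
qed

subsection \<open>Successor and addition\<close>

text \<open>The natural sum with any \<open>osingle b\<close> lies above a, so there is no largest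
  element.\<close>

lemma less_osuc [simp]: "(a::'o) < osuc a"
  unfolding osuc_def by (rule LeastI_ex) (use less_nsum_osingle in blast)

lemma osuc_le_iff: "osuc (a::'o) \<le> b \<longleftrightarrow> a < b"
  by (metis Least_le less_osuc order_less_le_trans osuc_def)

lemma less_osuc_iff: "(a::'o) < osuc b \<longleftrightarrow> a \<le> b"
  by (metis not_less osuc_le_iff)

lemma osuc_ne_zero [simp]: "osuc (a::'o) \<noteq> \<zero>"
  by (metis less_osuc not_less_ozero)

lemma oone_le_iff: "\<one> \<le> (a::'o) \<longleftrightarrow> a \<noteq> \<zero>"
  unfolding oone_def osuc_le_iff ozero_less_iff ..

lemma less_oone_iff: "(a::'o) < \<one> \<longleftrightarrow> a = \<zero>"
  by (meson not_less oone_le_iff)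

lemma oone_ne_zero [simp]: "\<one> \<noteq> (\<zero>::'o)"
  unfolding oone_def by simp

text \<open>The natural (Hessenberg) sum bounds the ordinal sum, so that the least upper bounds
in the recursion for addition exist.\<close>

lemma oadd_aux: "a \<oplus> b \<le> nsum a b \<and> a \<le> a \<oplus> b \<and> (\<forall>b'<b. a \<oplus> b' < a \<oplus> (b::'o))"
proof (induction b rule: less_induct)
  case (less b)
  have ex: "a \<le> nsum a b \<and> (\<forall>b'<b. a \<oplus> b' < nsum a b)"
    using less le_nsum nsum_strict by (meson order_le_less_trans)
  show ?case
    using Least_le[of "\<lambda>c. a \<le> c \<and> (\<forall>b'<b. a \<oplus> b' < c)", OF ex]
      LeastI[of "\<lambda>c. a \<le> c \<and> (\<forall>b'<b. a \<oplus> b' < c)", OF ex]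
    unfolding oadd_rec[of a b, symmetric] by blast
qed

lemma oadd_le_nsum: "a \<oplus> b \<le> nsum a b"
  and le_oadd1 [simp]: "a \<le> a \<oplus> (b::'o)"
  and oadd_strict: "b < b' \<Longrightarrow> a \<oplus> b < a \<oplus> (b'::'o)"
  using oadd_aux by blast+

lemma oadd_least: "a \<le> c \<Longrightarrow> (\<And>b'. b' < b \<Longrightarrow> a \<oplus> b' < c) \<Longrightarrow> a \<oplus> b \<le> (c::'o)"
  by (subst oadd_rec) (rule Least_le, blast)

lemma oadd_less_iff [simp]: "a \<oplus> b < a \<oplus> c \<longleftrightarrow> b < (c::'o)"
  by (metis linorder_less_linear oadd_strict order_less_asym)

lemma oadd_le_iff [simp]: "a \<oplus> b \<le> a \<oplus> c \<longleftrightarrow> b \<le> (c::'o)"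
  by (metis not_less oadd_less_iff)

lemma oadd_inject [simp]: "a \<oplus> b = a \<oplus> c \<longleftrightarrow> b = (c::'o)"
  by (metis linorder_less_linear oadd_strict order_less_irrefl)

lemma oadd_zero [simp]: "a \<oplus> \<zero> = (a::'o)"
  by (rule antisym) (auto intro: oadd_least)

lemma zero_oadd [simp]: "\<zero> \<oplus> b = (b::'o)"
proof (induction b rule: less_induct)
  case (less b)
  have "\<zero> \<oplus> b \<le> b" using less by (auto intro: oadd_least)
  moreover have "b \<le> \<zero> \<oplus> b"
    by (metis less linorder_not_le oadd_strict order_less_irrefl)
  ultimately show ?case by simp
qed

lemma oadd_osuc: "a \<oplus> osuc b = osuc (a \<oplus> (b::'o))"
proof (rule antisym)
  show "a \<oplus> osuc b \<le> osuc (a \<oplus> b)"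
    by (rule oadd_least) (auto simp: less_osuc_iff intro: order_trans[OF le_oadd1[of a b]] less_imp_le)
qed (simp add: osuc_le_iff)

lemma oadd_one: "a \<oplus> \<one> = osuc (a::'o)"
  by (simp add: oone_def oadd_osuc)

lemma oadd_mono_left: "a \<le> a' \<Longrightarrow> a \<oplus> b \<le> a' \<oplus> (b::'o)"
proof (induction b rule: less_induct)
  case (less b)
  then show ?case
    by (meson le_oadd1 oadd_least oadd_strict order_le_less_trans order_trans)
qed

lemma oadd_mono: "a \<le> a' \<Longrightarrow> b \<le> b' \<Longrightarrow> a \<oplus> b \<le> a' \<oplus> (b'::'o)"
  by (meson oadd_le_iff oadd_mono_left order_trans)

lemma le_oadd2 [simp]: "b \<le> a \<oplus> (b::'o)"
  using oadd_mono_left[of "\<zero>" a b] by simp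

text \<open>Left subtraction: the least c with \<open>b \<le> a \<oplus> c\<close> cannot overshoot,
  because smaller arguments stay below b.\<close>

lemma le_oaddE:
  assumes "a \<le> (b::'o)"
  obtains c where "b = a \<oplus> c"
proof -
  define c where "c = (LEAST c. b \<le> a \<oplus> c)"
  have "b \<le> a \<oplus> c" unfolding c_def by (rule LeastI[of _ b]) simp
  moreover have "a \<oplus> c \<le> b"
    using assms not_less_Least[of _ "\<lambda>c. b \<le> a \<oplus> c"] unfolding c_def not_le
    by (intro oadd_least) blast+
  ultimately show thesis using that by (meson antisym)
qed

lemma oadd_assoc: "a \<oplus> b \<oplus> c = a \<oplus> (b \<oplus> (c::'o))"
proof (induction c rule: less_induct)
  case (less c)
  show ?case
  proof (rule antisym)
    show "a \<oplus> b \<oplus> c \<le> a \<oplus> (b \<oplus> c)"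
      using less by (auto intro: oadd_least)
    show "a \<oplus> (b \<oplus> c) \<le> a \<oplus> b \<oplus> c"
    proof (rule oadd_least)
      show "a \<le> a \<oplus> b \<oplus> c" by (meson le_oadd1 order_trans)
      fix d assume d: "d < b \<oplus> c"
      show "a \<oplus> d < a \<oplus> b \<oplus> c"
      proof (cases "d < b")
        case True
        then show ?thesis by (meson le_oadd1 oadd_strict order_less_le_trans)
      next
        case False
        then obtain c' where c': "d = b \<oplus> c'" by (meson le_oaddE not_less)
        with d have "c' < c" by simp
        then show ?thesis using less[of c'] by (simp add: c' flip: less)
      qed
    qed
  qed
qed

lemma oadd_eq_zero_iff [simp]: "a \<oplus> b = \<zero> \<longleftrightarrow> a = \<zero> \<and> b = (\<zero>::'o)"
  by (metis le_oadd1 le_ozero_iff zero_oadd)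

subsection \<open>Multiplication\<close>

lemma oadd_less_osingle: "a < osingle c \<Longrightarrow> b < osingle c \<Longrightarrow> a \<oplus> b < osingle c"
  by (meson nsum_less_osingle oadd_le_nsum order_le_less_trans)

text \<open>Shifting all exponents by \<open>A\<close> multiplies by \<open>\<omega>\<close>-power \<open>A\<close> in the natural sense; this
bounds the product \<open>a \<odot> b\<close> as soon as \<open>a < osingle A\<close>.\<close>

definition shift :: "'o \<Rightarrow> 'o \<Rightarrow> 'o" where
  "shift A b = of_cnf (\<lambda>x. if A \<le> x then cnf b (THE y. x = A \<oplus> y) else 0)"

lemma cnf_shift: "cnf (shift A b) x = (if A \<le> x then cnf b (THE y. x = A \<oplus> y) else 0)"
proof -
  have "{x. (if A \<le> x then cnf b (THE y. x = A \<oplus> y) else 0) \<noteq> 0}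
      \<subseteq> (\<lambda>y. A \<oplus> y) ` {y. cnf b y \<noteq> 0}"
    by (auto elim!: le_oaddE split: if_splits)
  then have "finite {x. (if A \<le> x then cnf b (THE y. x = A \<oplus> y) else 0) \<noteq> 0}"
    by (rule finite_subset) (intro finite_imageI finite_cnf)
  then show ?thesis unfolding shift_def by (simp only: cnf_of_cnf)
qed

lemma cnf_shift_oadd [simp]: "cnf (shift A b) (A \<oplus> y) = cnf b y"
  by (simp add: cnf_shift)

text \<open>The shifted coefficients differ first at a position \<open>A \<oplus> x\<close>, where a
  has coefficient zero, so adding a cannot reverse the comparison.\<close>

lemma shift_oadd_less:
  assumes "b' < b" "a < osingle A"
  shows "shift A b' \<oplus> a < shift A b"
proof -
  obtain x where x: "cnf b' x < cnf b x" "\<forall>y>x. cnf b' y = cnf b y"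
    using assms(1) by (rule less_cnfE)
  have a: "cnf a y = 0" if "A \<le> y" for y using assms(2) that by (simp add: less_osingle)
  have "nsum (shift A b') a < shift A b"
  proof (rule less_cnfI)
    show "cnf (nsum (shift A b') a) (A \<oplus> x) < cnf (shift A b) (A \<oplus> x)"
      using x a by (simp add: cnf_nsum)
    fix y assume y: "A \<oplus> x < y"
    then obtain z where "y = A \<oplus> z" by (meson le_oadd1 le_oaddE less_imp_le order_trans)
    with y show "cnf (nsum (shift A b') a) y = cnf (shift A b) y"
      using x a by (simp add: cnf_nsum)
  qed
  then show ?thesis using oadd_le_nsum order_le_less_trans by blast
qed

lemma le_osingle: "a \<le> osingle a"
proof (induction a rule: less_induct)
  case (less a)
  then show ?case by (meson leI order_le_less_trans order_less_irrefl osingle_strict)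
qed

lemma omul_bound: "\<exists>c. \<forall>b'<b. a \<odot> b' \<oplus> a \<le> (c::'o)"
proof -
  define A where "A = osuc a"
  have A: "a < osingle A"
    using le_osingle[of A] unfolding A_def by (meson less_osuc order_less_le_trans)
  have "a \<odot> b \<le> shift A b \<and> (\<forall>b'<b. a \<odot> b' \<oplus> a \<le> shift A b)" for b
  proof (induction b rule: less_induct)
    case (less b)
    have *: "\<forall>b'<b. a \<odot> b' \<oplus> a \<le> shift A b"
      using less shift_oadd_less[OF _ A] by (meson less_imp_le oadd_mono_left order_trans)
    then show ?case by (subst omul_rec) (blast intro: Least_le)
  qed
  then show ?thesis by blast
qed

lemma omul_upper: "b' < b \<Longrightarrow> a \<odot> b' \<oplus> a \<le> a \<odot> (b::'o)"
  using LeastI_ex[OF omul_bound[of b a]] unfolding omul_rec[of a b, symmetric] by blast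

lemma omul_least: "(\<And>b'. b' < b \<Longrightarrow> a \<odot> b' \<oplus> a \<le> c) \<Longrightarrow> a \<odot> b \<le> (c::'o)"
  by (subst omul_rec) (rule Least_le, blast)

lemma omul_zero [simp]: "a \<odot> \<zero> = (\<zero>::'o)"
  by (metis le_ozero_iff not_less_ozero omul_least)

lemma omul_mono_right: "b \<le> b' \<Longrightarrow> a \<odot> b \<le> a \<odot> (b'::'o)"
  by (metis le_oadd1 omul_upper order_le_less order_trans)

lemma omul_osuc: "a \<odot> osuc b = a \<odot> b \<oplus> (a::'o)"
  by (rule antisym)
    (auto simp: less_osuc_iff intro!: omul_least omul_upper oadd_mono_left omul_mono_right)

lemma omul_one [simp]: "a \<odot> \<one> = (a::'o)"
  by (simp add: oone_def omul_osuc)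

lemma zero_omul [simp]: "\<zero> \<odot> a = (\<zero>::'o)"
proof -
  have "\<zero> \<odot> a \<le> \<zero>" for a :: 'o
    by (induction a rule: less_induct) (rule omul_least, simp)
  then show ?thesis by simp
qed

lemma omul_strict:
  assumes "a \<noteq> \<zero>" "b < b'"
  shows "a \<odot> b < a \<odot> (b'::'o)"
proof -
  have "a \<odot> b \<oplus> \<zero> < a \<odot> b \<oplus> a" using assms(1) by (subst oadd_less_iff) (simp add: ozero_less_iff)
  then show ?thesis using omul_upper[OF assms(2), of a] by simp
qed

lemma omul_less_iff: "a \<noteq> \<zero> \<Longrightarrow> a \<odot> b < a \<odot> c \<longleftrightarrow> b < (c::'o)"
  by (metis linorder_less_linear omul_strict order_less_asym)

lemma omul_le_iff: "a \<noteq> \<zero> \<Longrightarrow> a \<odot> b \<le> a \<odot> c \<longleftrightarrow> b \<le> (c::'o)"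
  by (metis not_less omul_less_iff)

lemma one_omul [simp]: "\<one> \<odot> d = (d::'o)"
proof (induction d rule: less_induct)
  case (less d)
  have "\<one> \<odot> d \<le> d" by (rule omul_least) (simp add: less oadd_one osuc_le_iff)
  moreover have "d \<le> \<one> \<odot> d"
    by (metis less leI omul_strict oone_ne_zero order_less_irrefl)
  ultimately show ?case by simp
qed

lemma omul_inject: "a \<noteq> \<zero> \<Longrightarrow> a \<odot> b = a \<odot> c \<longleftrightarrow> b = (c::'o)"
  by (metis linorder_less_linear omul_strict order_less_irrefl)

lemma omul_eq_zero_iff [simp]: "a \<odot> b = \<zero> \<longleftrightarrow> a = \<zero> \<or> b = (\<zero>::'o)"
  by (metis omul_inject omul_zero zero_omul)

lemma omul_mono_left: "a \<le> a' \<Longrightarrow> a \<odot> b \<le> a' \<odot> (b::'o)"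
proof (induction b rule: less_induct)
  case (less b)
  then show ?case by (meson oadd_mono omul_least omul_upper order_trans)
qed

lemma less_omulE:
  assumes "d < b \<odot> (c::'o)"
  obtains c' where "c' < c" "d < b \<odot> c' \<oplus> b"
  using assms omul_least by (meson leD leI)

lemma oadd_omul: "a \<odot> (b \<oplus> c) = a \<odot> b \<oplus> a \<odot> (c::'o)"
proof (cases "a = \<zero>")
  case a: False
  show ?thesis
  proof (induction c rule: less_induct)
    case (less c)
    show ?case
    proof (rule antisym)
      show "a \<odot> (b \<oplus> c) \<le> a \<odot> b \<oplus> a \<odot> c"
      proof (rule omul_least)
        fix d assume d: "d < b \<oplus> c"
        show "a \<odot> d \<oplus> a \<le> a \<odot> b \<oplus> a \<odot> c"
        proof (cases "d < b")
          case True
          then show ?thesis by (meson le_oadd1 omul_upper order_trans)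
        next
          case False
          then obtain c' where c': "d = b \<oplus> c'" by (meson le_oaddE not_less)
          with d have "c' < c" by simp
          then show ?thesis using less[of c'] by (simp add: c' oadd_assoc omul_upper)
        qed
      qed
      show "a \<odot> b \<oplus> a \<odot> c \<le> a \<odot> (b \<oplus> c)"
      proof (rule oadd_least)
        show "a \<odot> b \<le> a \<odot> (b \<oplus> c)" by (simp add: omul_mono_right)
        fix d assume "d < a \<odot> c"
        then obtain c' where c': "c' < c" "d < a \<odot> c' \<oplus> a" by (rule less_omulE)
        then have "a \<odot> b \<oplus> d < a \<odot> b \<oplus> (a \<odot> c' \<oplus> a)" by simp
        also have "\<dots> = a \<odot> (b \<oplus> c') \<oplus> a" using less[OF c'(1)] by (simp add: oadd_assoc)
        also have "\<dots> \<le> a \<odot> (b \<oplus> c)" using c' by (simp add: omul_upper)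
        finally show "a \<odot> b \<oplus> d < a \<odot> (b \<oplus> c)" .
      qed
    qed
  qed
qed simp

lemma omul_assoc: "a \<odot> b \<odot> c = a \<odot> (b \<odot> (c::'o))"
proof (induction c rule: less_induct)
  case (less c)
  have step: "a \<odot> b \<odot> c' \<oplus> a \<odot> b = a \<odot> (b \<odot> c' \<oplus> b)" if "c' < c" for c'
    using less[OF that] by (simp add: oadd_omul)
  show ?case
  proof (rule antisym)
    show "a \<odot> b \<odot> c \<le> a \<odot> (b \<odot> c)"
      by (rule omul_least) (simp add: step omul_mono_right omul_upper)
    show "a \<odot> (b \<odot> c) \<le> a \<odot> b \<odot> c"
    proof (rule omul_least)
      fix d assume "d < b \<odot> c"
      then obtain c' where c': "c' < c" "d < b \<odot> c' \<oplus> b" by (rule less_omulE)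
      have "a \<odot> d \<oplus> a \<le> a \<odot> (b \<odot> c' \<oplus> b)" using omul_upper[OF c'(2)] .
      also have "\<dots> \<le> a \<odot> b \<odot> c" using step[OF c'(1)] omul_upper[OF c'(1), of "a \<odot> b"] by simp
      finally show "a \<odot> d \<oplus> a \<le> a \<odot> b \<odot> c" .
    qed
  qed
qed

text \<open>Division with remainder; the quotient is the least q whose successor multiple exceeds
  c.\<close>

lemma odivE:
  assumes "a \<noteq> (\<zero>::'o)"
  obtains q r where "c = a \<odot> q \<oplus> r" "r < a"
proof -
  define q where "q = (LEAST q. c < a \<odot> osuc q)"
  have le: "x \<le> a \<odot> x" for x
  proof (induction x rule: less_induct)
    case (less x)
    then show ?case by (metis assms leI omul_strict order_less_irrefl order_le_less_trans)
  qed
  have "c < a \<odot> osuc c" using le less_osuc order_less_le_trans by blast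
  then have q: "c < a \<odot> osuc q" unfolding q_def by (rule LeastI)
  have "a \<odot> q \<le> c"
  proof (rule omul_least)
    fix q' assume "q' < q"
    then have "\<not> c < a \<odot> osuc q'" unfolding q_def by (rule not_less_Least)
    then show "a \<odot> q' \<oplus> a \<le> c" by (simp add: omul_osuc)
  qed
  then obtain r where "c = a \<odot> q \<oplus> r" by (rule le_oaddE)
  moreover from this have "r < a" using q by (simp add: omul_osuc)
  ultimately show thesis using that by blast
qed

subsection \<open>Powers of omega\<close>

lemma oomega_prop: "\<zero> < (oomega::'o) \<and> (\<forall>d<oomega. osuc d < (oomega::'o))"
proof -
  \<comment> \<open>\<open>osingle \<one>\<close> is closed under successors, so a nonzero limit
    exists.\<close>
  have "osuc d < osingle \<one>" if "d < osingle \<one>" for d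
  proof -
    have "osuc d \<le> nsum d (osingle \<zero>)" by (simp add: osuc_le_iff less_nsum_osingle)
    also have "\<dots> < osingle \<one>"
      using that by (intro nsum_less_osingle osingle_strict) (auto simp: oone_def)
    finally show ?thesis .
  qed
  moreover have "\<zero> < osingle \<one>"
    by (simp add: ozero_less_iff)
  ultimately have "\<exists>c::'o. \<zero> < c \<and> (\<forall>d<c. osuc d < c)" by blast
  from LeastI_ex[OF this] show ?thesis unfolding oomega_def .
qed

lemma oomega_ne_zero [simp]: "oomega \<noteq> (\<zero>::'o)"
  using oomega_prop by auto

lemma osuc_less_oomega: "d < (oomega::'o) \<Longrightarrow> osuc d < oomega"
  using oomega_prop by blast

lemma oone_less_oomega: "\<one> < (oomega::'o)"
  unfolding oone_def using oomega_prop by blast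

text \<open>By minimality of \<open>oomega\<close>, a nonzero element below it is no limit and hence
  has an immediate predecessor.\<close>

lemma less_oomegaE:
  assumes "d < (oomega::'o)"
  obtains "d = \<zero>" | e where "d = osuc e" "e < oomega"
proof -
  have "\<not> (\<zero> < d \<and> (\<forall>e<d. osuc e < d))"
    using assms not_less_Least unfolding oomega_def by blast
  then consider "d = \<zero>" | e where "e < d" "d \<le> osuc e"
    by (auto simp: ozero_less_iff not_less)
  then show thesis
  proof cases
    case (2 e)
    then have "d = osuc e" by (meson antisym osuc_le_iff)
    then show ?thesis using that(2)[of e] 2(1) assms by (meson order_less_trans)
  qed (use that in blast)
qed

lemma less_oomega_induct [consumes 1, case_names zero osuc]:
  assumes "d < (oomega::'o)" "P \<zero>" "\<And>e. e < oomega \<Longrightarrow> P e \<Longrightarrow> P (osuc e)"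
  shows "P d"
  using assms(1)
proof (induction d rule: less_induct)
  case (less d)
  from \<open>d < oomega\<close> show ?case by (rule less_oomegaE) (use less assms in auto)
qed

lemma finite_oadd_oomega:
  assumes "d < (oomega::'o)"
  shows "d \<oplus> oomega = oomega"
proof -
  have "d \<oplus> e < oomega" if "e < oomega" for e
    using that by (induction e rule: less_oomega_induct) (auto simp: assms oadd_osuc osuc_less_oomega)
  then show ?thesis using assms by (intro antisym oadd_least) auto
qed

text \<open>\<open>osingle b\<close> is the bound: it is closed under addition, hence under finite
  multiples, so \<open>a \<odot> oomega\<close> does not exceed it for any smaller a.\<close>

lemma oexpw_bound: "\<exists>c. \<one> \<le> c \<and> (\<forall>b'<b. oexpw b' \<odot> oomega \<le> (c::'o))"
proof -
  have *: "a \<odot> oomega \<le> osingle b" if a: "a < osingle b" for a b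
  proof -
    have "a \<odot> d < osingle b" if "d < oomega" for d
      using that
    proof (induction d rule: less_oomega_induct)
      case zero
      then show ?case using a by (metis less_osingle omul_zero ozero_less_iff order_le_less_trans ozero_le)
    qed (auto simp: omul_osuc intro: oadd_less_osingle a)
    then show ?thesis by (intro omul_least less_imp_le oadd_less_osingle a)
  qed
  have one: "\<one> \<le> osingle b" for b
    by (simp add: oone_le_iff)
  have "oexpw b \<le> osingle b \<and> (\<forall>b'<b. oexpw b' \<odot> oomega \<le> osingle b)" for b
  proof (induction b rule: less_induct)
    case (less b)
    have **: "\<one> \<le> osingle b \<and> (\<forall>b'<b. oexpw b' \<odot> oomega \<le> osingle b)"
      using less one * osingle_strict by (meson order_le_less_trans)
    then show ?case by (subst oexpw_rec) (blast intro: Least_le)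
  qed
  then show ?thesis using one by blast
qed

lemma oexpw_upper: "\<one> \<le> oexpw (b::'o)" "b' < b \<Longrightarrow> oexpw b' \<odot> oomega \<le> oexpw (b::'o)"
  using LeastI_ex[OF oexpw_bound[of b]] unfolding oexpw_rec[of b, symmetric] by blast+

lemma oexpw_least: "\<one> \<le> c \<Longrightarrow> (\<And>b'. b' < b \<Longrightarrow> oexpw b' \<odot> oomega \<le> c) \<Longrightarrow> oexpw b \<le> (c::'o)"
  by (subst oexpw_rec) (rule Least_le, blast)

lemma oexpw_ne_zero [simp]: "oexpw (b::'o) \<noteq> \<zero>"
  using oexpw_upper(1) by (simp add: oone_le_iff)

lemma oexpw_zero [simp]: "oexpw \<zero> = (\<one>::'o)"
  by (intro antisym oexpw_least oexpw_upper) auto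

lemma oexpw_strict:
  assumes "a < b"
  shows "oexpw a < oexpw (b::'o)"
  using omul_strict[OF oexpw_ne_zero oone_less_oomega, of a] oexpw_upper(2)[OF assms] by simp

lemma oexpw_less_iff [simp]: "oexpw a < oexpw b \<longleftrightarrow> a < (b::'o)"
  by (metis linorder_less_linear oexpw_strict order_less_asym)

lemma oexpw_le_iff [simp]: "oexpw a \<le> oexpw b \<longleftrightarrow> a \<le> (b::'o)"
  by (metis not_less oexpw_less_iff)

lemma le_oexpw: "a \<le> oexpw (a::'o)"
proof (induction a rule: less_induct)
  case (less a)
  then show ?case by (meson leI order_le_less_trans order_less_irrefl oexpw_strict)
qed

lemma less_oexpwE:
  assumes "d < oexpw (b::'o)"
  obtains "d = \<zero>" | b' where "b' < b" "d < oexpw b' \<odot> oomega"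
  using assms oexpw_least by (metis leD leI less_oone_iff)

lemma oexpw_oadd: "oexpw (a \<oplus> b) = oexpw a \<odot> oexpw (b::'o)"
proof (induction b rule: less_induct)
  case (less b)
  show ?case
  proof (rule antisym)
    show "oexpw (a \<oplus> b) \<le> oexpw a \<odot> oexpw b"
    proof (rule oexpw_least)
      show "\<one> \<le> oexpw a \<odot> oexpw b" by (simp add: oone_le_iff)
      fix d assume d: "d < a \<oplus> b"
      show "oexpw d \<odot> oomega \<le> oexpw a \<odot> oexpw b"
      proof (cases "d < a")
        case True
        have "oexpw d \<odot> oomega \<le> oexpw a \<odot> \<one>" using oexpw_upper(2)[OF True] by simp
        also have "\<dots> \<le> oexpw a \<odot> oexpw b" by (intro omul_mono_right oexpw_upper)
        finally show ?thesis .
      next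
        case False
        then obtain b' where b': "d = a \<oplus> b'" by (meson le_oaddE not_less)
        with d have "b' < b" by simp
        then show ?thesis using less[of b'] by (simp add: b' omul_assoc omul_mono_right oexpw_upper)
      qed
    qed
    show "oexpw a \<odot> oexpw b \<le> oexpw (a \<oplus> b)"
    proof (rule omul_least)
      fix d assume "d < oexpw b"
      then show "oexpw a \<odot> d \<oplus> oexpw a \<le> oexpw (a \<oplus> b)"
      proof (rule less_oexpwE)
        fix b' assume b': "b' < b" "d < oexpw b' \<odot> oomega"
        have "oexpw a \<odot> d \<oplus> oexpw a \<le> oexpw a \<odot> (oexpw b' \<odot> oomega)"
          by (rule omul_upper[OF b'(2)])
        also have "\<dots> = oexpw (a \<oplus> b') \<odot> oomega" by (simp add: less b' omul_assoc)
        also have "\<dots> \<le> oexpw (a \<oplus> b)" using b' by (simp add: oexpw_upper)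
        finally show ?thesis .
      qed simp
    qed
  qed
qed

lemma oexpw_oone [simp]: "oexpw \<one> = (oomega::'o)"
  using oexpw_upper(2)[of "\<zero>" "\<one>"] oone_less_oomega
  by (intro antisym oexpw_least) (auto simp: less_oone_iff ozero_less_iff)

lemma oexpw_osuc: "oexpw (osuc b) = oexpw b \<odot> (oomega::'o)"
  by (simp add: oexpw_oadd flip: oadd_one)

text \<open>Powers of omega absorb smaller elements on the left: r lies below a finite multiple of
  some omega^q' with q' < q, while omega^q is omega^q' times a factor beginning with omega, which
  absorbs finite summands.\<close>

lemma less_oexpw_oadd:
  assumes "r < oexpw (q::'o)"
  shows "r \<oplus> oexpw q = oexpw q"
  using assms
proof (rule less_oexpwE)
  fix q' assume q': "q' < q" "r < oexpw q' \<odot> oomega"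
  obtain t where t: "q = osuc q' \<oplus> t" using q'(1) by (metis le_oaddE osuc_le_iff)
  obtain t' where t': "oexpw t = \<one> \<oplus> t'" using oexpw_upper(1) by (rule le_oaddE)
  have q: "oexpw q = oexpw q' \<odot> (oomega \<oplus> oomega \<odot> t')"
    by (simp add: t oexpw_oadd oexpw_osuc omul_assoc t' oadd_omul)
  obtain n where n: "n < oomega" "r < oexpw q' \<odot> n \<oplus> oexpw q'" using q'(2) by (rule less_omulE)
  then have "r \<le> oexpw q' \<odot> osuc n" by (simp add: omul_osuc)
  then have "r \<oplus> oexpw q \<le> oexpw q' \<odot> osuc n \<oplus> oexpw q" by (rule oadd_mono_left)
  also have "\<dots> = oexpw q' \<odot> (osuc n \<oplus> oomega \<oplus> oomega \<odot> t')"
    by (simp add: q oadd_omul oadd_assoc)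
  also have "\<dots> = oexpw q" using n by (simp add: q finite_oadd_oomega osuc_less_oomega)
  finally show ?thesis by (simp add: antisym)
qed simp

section \<open>Hyper-exponentials\<close>

lemma hexp_zero [simp]: "hexp \<zero> = (\<zero>::'o)"
proof -
  have "\<one> \<oplus> g = \<one> \<longleftrightarrow> g = \<zero>" for g :: 'o
    using oadd_inject[of "\<one>" g "\<zero>"] by simp
  then show ?thesis by (simp add: hexp_def ominus1_def)
qed

text \<open>A nontrivial power of omega absorbs a leading one, so subtracting one on the left
  changes nothing.\<close>

lemma hexp_eq_oexpw: "a \<noteq> \<zero> \<Longrightarrow> hexp a = oexpw (a::'o)"
proof -
  assume "a \<noteq> \<zero>"
  then have *: "\<one> \<oplus> oexpw a = oexpw a"
    using oexpw_less_iff[of "\<zero>" a] by (intro less_oexpw_oadd) (simp add: ozero_less_iff)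
  show ?thesis unfolding hexp_def ominus1_def
    by (rule the_equality) (use * oadd_inject in metis)+
qed

lemma hexp_strict: "a < b \<Longrightarrow> hexp a < hexp (b::'o)"
  by (cases "a = \<zero>"; cases "b = \<zero>") (auto simp: hexp_eq_oexpw ozero_less_iff)

lemma hexp_mono: "a \<le> b \<Longrightarrow> hexp a \<le> hexp (b::'o)"
  by (metis hexp_strict order_le_less)

lemma hexp_eq_zero_iff [simp]: "hexp a = \<zero> \<longleftrightarrow> a = (\<zero>::'o)"
  by (metis hexp_eq_oexpw hexp_zero oexpw_ne_zero)

lemma hexpn_mono: "a \<le> b \<Longrightarrow> hexpn k a \<le> hexpn k (b::'o)"
  by (induction k) (auto intro: hexp_mono)

lemma hexpn_zero [simp]: "hexpn k \<zero> = (\<zero>::'o)"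
  by (induction k) auto

lemma hexpn_eq_zero_iff [simp]: "hexpn k a = \<zero> \<longleftrightarrow> a = (\<zero>::'o)"
  by (induction k) auto

subsection \<open>Multiples of powers of omega\<close>

text \<open>Divisibility by omega^q. Zero is divisible by every power, which is where this differs
  from \<open>q \<le> ologd x\<close>.\<close>

definition omult :: "'o \<Rightarrow> 'o \<Rightarrow> bool" where
  "omult q x \<longleftrightarrow> (\<exists>g. x = oexpw q \<odot> g)"

lemma omult_trans: "omult q x \<Longrightarrow> q' \<le> q \<Longrightarrow> omult q' x"
  unfolding omult_def by (metis le_oaddE oexpw_oadd omul_assoc)

lemma omult_zero [simp]: "omult \<zero> x"
proof -
  obtain q r where "x = oexpw \<zero> \<odot> q \<oplus> r" "r < oexpw (\<zero>::'o)" by (rule odivE[OF oexpw_ne_zero])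
  then show ?thesis unfolding omult_def by (intro exI[of _ q]) (simp add: less_oone_iff)
qed

lemma omult_oadd: "omult q x \<Longrightarrow> omult q (x \<oplus> oexpw q \<odot> a)"
  unfolding omult_def by (metis oadd_omul)

lemma omult_hexp [simp]: "omult q (hexp q)"
  unfolding omult_def by (cases "q = \<zero>") (metis omul_zero hexp_zero, metis hexp_eq_oexpw omul_one)

text \<open>Since r exceeds q, x is omega^q times a multiple of omega, and is therefore a limit of
  multiples of omega^q.\<close>

lemma omult_limit:
  assumes "omult r x" "q < r" "c < x"
  obtains u where "c < u" "u < x" "omult q u"
proof -
  obtain t where t: "r = osuc q \<oplus> t" using assms(2) by (metis le_oaddE osuc_le_iff)
  obtain g where x: "x = oexpw r \<odot> g" using assms(1) unfolding omult_def by blast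
  have x': "x = oexpw q \<odot> (oomega \<odot> (oexpw t \<odot> g))"
    by (simp add: x t oexpw_oadd oexpw_osuc omul_assoc)
  with assms(3) obtain d where d: "d < oomega \<odot> (oexpw t \<odot> g)" "c < oexpw q \<odot> d \<oplus> oexpw q"
    by (metis less_omulE)
  obtain e where e: "e < oexpw t \<odot> g" "d < oomega \<odot> e \<oplus> oomega" using d(1) by (rule less_omulE)
  \<comment> \<open>The right side is a limit, so the next multiple of omega^q after c is still
    below x.\<close>
  have "osuc d < oomega \<odot> e \<oplus> oomega"
  proof (cases "d < oomega \<odot> e")
    case True
    then have "osuc d \<le> oomega \<odot> e" by (simp add: osuc_le_iff)
    also have "\<dots> < oomega \<odot> e \<oplus> oomega"
      using oadd_less_iff[of "oomega \<odot> e" "\<zero>" oomega] by (simp add: ozero_less_iff)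
    finally show ?thesis .
  next
    case False
    then obtain f where f: "d = oomega \<odot> e \<oplus> f" by (meson le_oaddE not_less)
    with e show ?thesis by (simp add: osuc_less_oomega flip: oadd_osuc)
  qed
  also have "\<dots> \<le> oomega \<odot> (oexpw t \<odot> g)" by (rule omul_upper[OF e(1)])
  finally have "oexpw q \<odot> osuc d < x" unfolding x' by (simp add: omul_less_iff)
  moreover have "c < oexpw q \<odot> osuc d" using d(2) by (simp add: omul_osuc)
  ultimately show thesis using that unfolding omult_def by blast
qed

lemma osuc_less_omult:
  assumes "omult r x" "r \<noteq> \<zero>" "c < x"
  shows "osuc c < x"
  using assms by (metis omult_limit osuc_le_iff order_le_less_trans ozero_less_iff)

text \<open>Adding omega^r absorbs the remainder of y modulo omega^r, so the sum is only the next
  multiple of omega^r after y.\<close>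

lemma oadd_oexpw_le:
  assumes "omult r x" "y < x"
  shows "y \<oplus> oexpw r \<le> x"
proof -
  obtain g where x: "x = oexpw r \<odot> g" using assms(1) unfolding omult_def by blast
  obtain h s where y: "y = oexpw r \<odot> h \<oplus> s" "s < oexpw r" by (rule odivE[OF oexpw_ne_zero])
  have "h < g"
  proof (rule ccontr)
    assume "\<not> h < g"
    then have "x \<le> oexpw r \<odot> h" by (simp add: x omul_le_iff)
    then show False using assms(2) y by (metis le_oadd1 leD order_trans)
  qed
  then show ?thesis using omul_upper[of h g "oexpw r"] by (simp add: x y oadd_assoc less_oexpw_oadd)
qed

section \<open>The last term of the Cantor normal form, and the logarithm\<close>

lemma oexpw_tail:
  assumes "x \<noteq> (\<zero>::'o)"
  obtains g b where "x = g \<oplus> oexpw b"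
proof -
  \<comment> \<open>r will be the least nonzero tail of x, and omega^b the largest power not above
    r.\<close>
  define P where "P r \<longleftrightarrow> r \<noteq> \<zero> \<and> (\<exists>g. x = g \<oplus> r)" for r
  define r where "r = (LEAST r. P r)"
  have "P x" unfolding P_def using assms by (metis zero_oadd)
  then have Pr: "P r" unfolding r_def by (rule LeastI)
  have min: "r \<le> s" if "P s" for s unfolding r_def using that by (rule Least_le)
  from Pr obtain g where r: "r \<noteq> \<zero>" "x = g \<oplus> r" unfolding P_def by blast
  have tail: "r \<le> s" if "r = a \<oplus> s" "s \<noteq> \<zero>" for a s
    using that r by (intro min) (auto simp: P_def simp flip: oadd_assoc)
  define b where "b = (LEAST b. r < oexpw (osuc b))"
  have "r < oexpw (osuc r)" using le_oexpw less_osuc order_less_le_trans by blast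
  then have b: "r < oexpw (osuc b)" unfolding b_def by (rule LeastI)
  have "oexpw b \<le> r"
  proof (rule oexpw_least)
    fix b' assume "b' < b"
    then have "\<not> r < oexpw (osuc b')" unfolding b_def by (rule not_less_Least)
    then show "oexpw b' \<odot> oomega \<le> r" by (simp add: oexpw_osuc)
  qed (use r in \<open>simp add: oone_le_iff\<close>)
  obtain q s where s: "r = oexpw b \<odot> q \<oplus> s" "s < oexpw b" by (rule odivE[OF oexpw_ne_zero])
  \<comment> \<open>A nonzero remainder would be a smaller tail. So r is a finite nonzero multiple
    of omega^b, whose last summand is the required power.\<close>
  have "s = \<zero>" using tail[OF s(1)] s(2) \<open>oexpw b \<le> r\<close> by (meson leD order_trans)
  with s have rq: "r = oexpw b \<odot> q" by simp
  then have "q < oomega" using b by (simp add: oexpw_osuc omul_less_iff)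
  then show thesis
  proof (rule less_oomegaE)
    fix e assume e: "q = osuc e"
    then have "x = g \<oplus> oexpw b \<odot> e \<oplus> oexpw b" using r rq by (simp add: omul_osuc oadd_assoc)
    then show thesis by (rule that)
  qed (use rq r in simp)
qed

text \<open>Justifies the \<open>THE\<close> in \<open>ologd\<close>. If b < b', cancelling the
  shorter prefix leaves either omega^b with the larger tail omega^b', or omega^b' = k + omega^b with
  k absorbed by omega^b'.\<close>

lemma oexpw_tail_unique:
  assumes "g \<oplus> oexpw b = g' \<oplus> oexpw (b'::'o)"
  shows "b = b'"
proof -
  have "\<not> b < b'" if eq: "g \<oplus> oexpw b = g' \<oplus> oexpw (b'::'o)" for g g' b b'
  proof
    assume bb: "b < b'"
    show False
    proof (cases "g \<le> g'")
      case True
      then obtain k where "g' = g \<oplus> k" by (rule le_oaddE)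
      with eq have "oexpw b = k \<oplus> oexpw b'" by (simp add: oadd_assoc)
      then show False using bb by (metis le_oadd2 leD oexpw_strict)
    next
      case False
      then obtain k where "g = g' \<oplus> k" by (meson le_oaddE linear)
      with eq have k: "oexpw b' = k \<oplus> oexpw b" by (simp add: oadd_assoc)
      have "k \<noteq> oexpw b'"
        using k oadd_inject[of k "oexpw b" "\<zero>"] by auto
      then have "k \<oplus> oexpw b' = oexpw b'"
        using k le_oadd1[of k "oexpw b"] by (intro less_oexpw_oadd) (simp add: order_less_le)
      with k have "oexpw b' = oexpw b" by (metis oadd_inject)
      then show False using oexpw_strict[OF bb] by simp
    qed
  qed
  from this[OF assms] this[OF assms[symmetric]] show ?thesis by simp
qed

text \<open>Turns every statement about logarithms into one about divisibility by powers of
  omega.\<close>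

lemma le_ologd_iff:
  assumes "x \<noteq> \<zero>"
  shows "q \<le> ologd x \<longleftrightarrow> omult q x"
proof -
  obtain g b where x: "x = g \<oplus> oexpw b" using assms by (rule oexpw_tail)
  have log: "ologd x = b"
    unfolding ologd_def using assms x by (auto intro!: the_equality dest: oexpw_tail_unique)
  have "omult q x" if qb: "q \<le> b"
  proof -
    obtain h s where s: "g = oexpw q \<odot> h \<oplus> s" "s < oexpw q" by (rule odivE[OF oexpw_ne_zero])
    obtain t where t: "b = q \<oplus> t" using qb by (rule le_oaddE)
    have "s < oexpw b" using s qb by (meson oexpw_le_iff order_less_le_trans)
    then have "x = oexpw q \<odot> h \<oplus> oexpw b" by (simp add: x s oadd_assoc less_oexpw_oadd)
    also have "\<dots> = oexpw q \<odot> (h \<oplus> oexpw t)" by (simp add: t oadd_omul oexpw_oadd)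
    finally show ?thesis unfolding omult_def by blast
  qed
  moreover have "q \<le> b" if qx: "omult q x"
  proof -
    obtain h where h: "x = oexpw q \<odot> h" using qx unfolding omult_def by blast
    with assms have "h \<noteq> \<zero>" by auto
    then obtain k c where "h = k \<oplus> oexpw c" by (rule oexpw_tail)
    with h x have "g \<oplus> oexpw b = oexpw q \<odot> k \<oplus> oexpw (q \<oplus> c)" by (simp add: oadd_omul oexpw_oadd)
    then have "b = q \<oplus> c" by (rule oexpw_tail_unique)
    then show ?thesis by simp
  qed
  ultimately show ?thesis using log by blast
qed

lemma ologd_zero [simp]: "ologd \<zero> = (\<zero>::'o)"
  by (simp add: ologd_def)

lemma le_ologd: "q \<le> ologd x \<longleftrightarrow> omult q x \<and> (x = \<zero> \<longrightarrow> q = \<zero>)"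
  using le_ologd_iff by (cases "x = \<zero>") auto

subsection \<open>The frame of l-sequences\<close>

lemma Hset_iff: "x \<in> Hset \<longleftrightarrow> (\<forall>i. x (Suc i) \<le> ologd (x i)) \<and> (\<exists>i. x i = (\<zero>::'o))"
  unfolding Hset_def ell_seq_def by simp

lemma Hset_ologd: "x \<in> Hset \<Longrightarrow> x (Suc i) \<le> ologd (x i :: 'o)"
  by (simp add: Hset_iff)

lemma Hset_omult: "x \<in> Hset \<Longrightarrow> omult (x (Suc i)) (x i)"
  using Hset_ologd le_ologd by blast

lemma Hset_zero_mono:
  assumes "x \<in> Hset" "x i = (\<zero>::'o)" "i \<le> j"
  shows "x j = \<zero>"
  using assms(3) by (induction j rule: dec_induct) (use assms Hset_ologd[of x] in \<open>metis ologd_zero le_ozero_iff\<close>)+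

lemma Hset_nonzero: "x \<in> Hset \<Longrightarrow> x j \<noteq> (\<zero>::'o) \<Longrightarrow> i \<le> j \<Longrightarrow> x i \<noteq> \<zero>"
  using Hset_zero_mono by blast

lemma zero_in_Hset [simp]: "(\<lambda>_. \<zero>::'o) \<in> Hset"
  by (simp add: Hset_iff)

lemma hexp_le:
  assumes "q \<le> ologd (x::'o)"
  shows "hexp q \<le> x"
proof (cases "q = \<zero>")
  case False
  then show ?thesis using assms oadd_oexpw_le[of q x "\<zero>"] unfolding le_ologd
    by (auto simp: hexp_eq_oexpw ozero_less_iff)
qed simp

section \<open>Rounding up, and least completions of partial sequences\<close>

definition rd :: "'o \<Rightarrow> 'o \<Rightarrow> 'o" where
  "rd q c = (LEAST w. c \<le> w \<and> q \<le> ologd w)"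

text \<open>The next successor multiple of omega^q above c shows that the minimum exists. It is
  nonzero, which matters because \<open>ologd \<zero> = \<zero>\<close>: for positive q, rounding
  zero gives a positive value.\<close>

lemma le_rd: "c \<le> rd q c" and rd_ologd: "q \<le> ologd (rd q c)"
proof -
  obtain h r where c: "c = oexpw q \<odot> h \<oplus> r" "r < oexpw q" by (rule odivE[OF oexpw_ne_zero])
  then have "c < oexpw q \<odot> osuc h" by (simp add: omul_osuc)
  moreover have "q \<le> ologd (oexpw q \<odot> osuc h)" by (simp add: le_ologd omult_def) blast
  ultimately have "\<exists>w. c \<le> w \<and> q \<le> ologd w" by (meson less_imp_le)
  then have "c \<le> rd q c \<and> q \<le> ologd (rd q c)" unfolding rd_def by (rule LeastI_ex)
  then show "c \<le> rd q c" "q \<le> ologd (rd q c)" by auto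
qed

lemma rd_least: "c \<le> w \<Longrightarrow> q \<le> ologd w \<Longrightarrow> rd q c \<le> w"
  unfolding rd_def by (simp add: Least_le)

text \<open>A strict gap between the exponents makes w a limit of multiples of omega^q, leaving one
  between c and w.\<close>

lemma rd_less:
  assumes "q < r" "r \<le> ologd w" "c < w"
  shows "rd q c < w"
proof -
  obtain u where u: "c < u" "u < w" "omult q u"
    using assms omult_limit le_ologd by metis
  then have "q \<le> ologd u" unfolding le_ologd by auto
  with u show ?thesis by (meson rd_least less_imp_le order_le_less_trans)
qed

text \<open>Keeps u from k on and proceeds downward; each lower entry is the least value above c
  compatible with the entry already fixed to its right.\<close>

primrec fill :: "nat \<Rightarrow> (nat \<Rightarrow> 'o) \<Rightarrow> (nat \<Rightarrow> 'o) \<Rightarrow> nat \<Rightarrow> 'o" where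
  "fill 0 u c = u"
| "fill (Suc k) u c = fill k (u(k := rd (u (Suc k)) (c k))) c"

lemma fill_same: "k \<le> i \<Longrightarrow> fill k u c i = u i"
  by (induction k arbitrary: u) auto

lemma fill_in_Hset:
  assumes "\<And>i. k \<le> i \<Longrightarrow> u (Suc i) \<le> ologd (u i)" "k \<le> j" "u j = \<zero>"
  shows "fill k u c \<in> Hset"
  using assms
proof (induction k arbitrary: u)
  case 0
  then show ?case by (auto simp: Hset_iff)
next
  case (Suc k)
  show ?case unfolding fill.simps
  proof (rule Suc.IH)
    fix i assume "k \<le> i"
    then show "(u(k := rd (u (Suc k)) (c k))) (Suc i) \<le> ologd ((u(k := rd (u (Suc k)) (c k))) i)"
      using Suc.prems(1)[of i] by (cases "i = k") (auto simp: rd_ologd)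
  qed (use Suc.prems in auto)
qed

lemma fill_ge: "i < k \<Longrightarrow> c i \<le> fill k u c i"
proof (induction k arbitrary: u)
  case (Suc k)
  then show ?case by (cases "i = k") (auto simp: fill_same le_rd)
qed simp

lemma fill_least:
  assumes "x \<in> Hset" "\<And>i. k \<le> i \<Longrightarrow> u i \<le> x i" "\<And>i. i < k \<Longrightarrow> c i \<le> x i"
  shows "fill k u c i \<le> x i"
  using assms(2,3)
proof (induction k arbitrary: u)
  case (Suc k)
  show ?case unfolding fill.simps
  proof (rule Suc.IH)
    fix i assume "k \<le> i"
    then show "(u(k := rd (u (Suc k)) (c k))) i \<le> x i"
      using Suc.prems Hset_ologd[OF assms(1), of k]
      by (cases "i = k") (auto intro!: rd_least intro: order_trans)
  qed (use Suc.prems in auto)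
qed simp

text \<open>Strictness travels downward: a strict inequality at one level is the exponent gap that
  \<open>rd_less\<close> needs one level lower.\<close>

lemma fill_less:
  assumes "x \<in> Hset" "u k < x k" "\<And>i. i < k \<Longrightarrow> c i < x i" "i \<le> k"
  shows "fill k u c i < x i"
  using assms(2-)
proof (induction k arbitrary: u)
  case (Suc k)
  show ?case
  proof (cases "i \<le> k")
    case True
    have "rd (u (Suc k)) (c k) < x k"
      using rd_less[OF Suc.prems(1) Hset_ologd[OF assms(1)]] Suc.prems by simp
    then show ?thesis using Suc True by simp
  qed (use Suc.prems fill_same[of "Suc k" "Suc k" u c] in \<open>simp add: le_Suc_eq\<close>)
qed simp

subsection \<open>Iterated accessibility\<close>

text \<open>Closed form of \<open>Srel_pow\<close>, with the end point y written first. The two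
  agree only for nonzero a: \<open>reach n \<zero>\<close> still demands strictness below n.\<close>

definition reach :: "nat \<Rightarrow> 'o \<Rightarrow> (nat \<Rightarrow> 'o) \<Rightarrow> (nat \<Rightarrow> 'o) \<Rightarrow> bool" where
  "reach n a y x \<longleftrightarrow> y n \<oplus> oexpw (y (Suc n)) \<odot> a \<le> x n \<and> (\<forall>i<n. y i < x i) \<and> (\<forall>i>n. y i \<le> x i)"

text \<open>For y in H, the least point x of H with \<open>reach n a y x\<close>.\<close>

definition step :: "nat \<Rightarrow> 'o \<Rightarrow> (nat \<Rightarrow> 'o) \<Rightarrow> nat \<Rightarrow> 'o" where
  "step n a y = fill n (y(n := y n \<oplus> oexpw (y (Suc n)) \<odot> a)) (\<lambda>i. osuc (y i))"

lemma step_at [simp]: "step n a y n = y n \<oplus> oexpw (y (Suc n)) \<odot> a"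
  and step_above [simp]: "n < i \<Longrightarrow> step n a y i = y i"
  and step_below: "i < n \<Longrightarrow> y i < step n a y i"
  using fill_ge[of i n "\<lambda>i. osuc (y i)"] by (auto simp: step_def fill_same osuc_le_iff)

lemma step_in_Hset:
  assumes "y \<in> Hset"
  shows "step n a y \<in> Hset"
proof -
  obtain j where "y j = \<zero>" using assms by (auto simp: Hset_iff)
  then have j: "y (max j (Suc n)) = \<zero>" using assms Hset_zero_mono max.cobounded1 by blast
  show ?thesis unfolding step_def
  proof (rule fill_in_Hset[of _ _ "max j (Suc n)"])
    fix i assume "n \<le> i"
    then show "(y(n := y n \<oplus> oexpw (y (Suc n)) \<odot> a)) (Suc i)
        \<le> ologd ((y(n := y n \<oplus> oexpw (y (Suc n)) \<odot> a)) i)"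
      using Hset_ologd[OF assms, of i] by (auto simp: le_ologd omult_oadd)
  qed (use j in \<open>auto simp: max_def split: if_splits\<close>)
qed

lemma step_less:
  assumes "x \<in> Hset" "y n \<oplus> oexpw (y (Suc n)) \<odot> a < x n" "\<And>i. i < n \<Longrightarrow> y i < x i" "i \<le> n"
  shows "step n a y i < x i"
  unfolding step_def
proof (rule fill_less[OF assms(1) _ _ assms(4)])
  fix i assume i: "i < n"
  \<comment> \<open>A nonzero next entry makes \<open>x i\<close> a limit, so the successor of
    \<open>y i\<close> still fits strictly below it.\<close>
  have "x (Suc i) \<noteq> \<zero>" using assms(2,3) i by (metis Suc_lessI not_less_ozero)
  then show "osuc (y i) < x i" using osuc_less_omult[OF Hset_omult[OF assms(1)]] assms(3) i by simp
qed (use assms in simp)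

lemma reach_iff_step:
  assumes "x \<in> Hset"
  shows "reach n a y x \<longleftrightarrow> step n a y \<le> x"
proof
  assume r: "reach n a y x"
  then show "step n a y \<le> x" unfolding step_def le_fun_def reach_def
    by (intro allI fill_least assms) (auto simp: osuc_le_iff)
next
  assume "step n a y \<le> x"
  then have s: "step n a y i \<le> x i" for i by (rule le_funD)
  have "y i < x i" if "i < n" for i
    using step_below[OF that] s[of i] by (rule order_less_le_trans)
  moreover have "y i \<le> x i" if "n < i" for i
    using s[of i] that by simp
  ultimately show "reach n a y x" using s[of n] unfolding reach_def by simp
qed

lemma reach_antimono: "reach n a y x \<Longrightarrow> z \<le> y \<Longrightarrow> reach n a z x"
  unfolding reach_def le_fun_def
  by (meson oadd_mono oexpw_le_iff omul_mono_left order_le_less_trans order_trans)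

lemma reach_mono_exponent: "reach n a y x \<Longrightarrow> b \<le> a \<Longrightarrow> reach n b y x"
  unfolding reach_def by (meson oadd_le_iff omul_mono_right order_trans)

lemma reach_le: "reach n a y x \<Longrightarrow> y \<le> x"
  unfolding reach_def le_fun_def
  by (metis le_oadd1 less_imp_le linorder_cases order_trans)

lemma reach_less:
  assumes "reach n a y x" "a \<noteq> \<zero>" "i \<le> n"
  shows "y i < x i"
proof (cases "i = n")
  case True
  have "y n \<oplus> \<zero> < y n \<oplus> oexpw (y (Suc n)) \<odot> a"
    by (subst oadd_less_iff) (simp add: assms(2) ozero_less_iff)
  then show ?thesis
    using assms(1) True unfolding reach_def by (metis oadd_zero order_less_le_trans)
qed (use assms in \<open>auto simp: reach_def\<close>)

lemma Srel_pow_iff: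
  assumes "x \<in> Hset" "y \<in> Hset" "a \<noteq> \<zero>"
  shows "Srel_pow n a x y \<longleftrightarrow> reach n a y x"
  using assms(1,3)
proof (induction a arbitrary: x rule: less_induct)
  case (less a)
  let ?p = "y (Suc n)"
  show ?case
  proof
    assume pow: "Srel_pow n a x y"
    then have S: "\<exists>z\<in>Hset. Srel n x z \<and> Srel_pow n b z y" if "b < a" for b
      using that less.prems Srel_pow_rec by metis
    have xy: "Srel n x y" using S[of "\<zero>"] less.prems by (auto simp: ozero_less_iff)
    have "y n \<oplus> oexpw ?p \<odot> a \<le> x n"
    proof (rule ccontr)
      assume "\<not> y n \<oplus> oexpw ?p \<odot> a \<le> x n"
      then have lt: "x n < y n \<oplus> oexpw ?p \<odot> a" by simp
      have "y n \<le> x n" using xy unfolding Srel_def by (simp add: less_imp_le)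
      then obtain d where d: "x n = y n \<oplus> d" by (rule le_oaddE)
      \<comment> \<open>b numbers the block of length omega^p in which \<open>x n\<close> falls
        short.\<close>
      then obtain b where b: "b < a" "d < oexpw ?p \<odot> b \<oplus> oexpw ?p"
        using lt by (metis less_omulE oadd_less_iff)
      obtain z where z: "z \<in> Hset" "Srel n x z" "Srel_pow n b z y" using S[OF b(1)] by blast
      have "y n \<oplus> oexpw ?p \<odot> b \<le> z n"
      proof (cases "b = \<zero>")
        case False
        then show ?thesis using less.IH[OF b(1) z(1)] z(3) unfolding reach_def by blast
      qed (use z in simp)
      also have "z n < x n" using z(2) unfolding Srel_def by simp
      finally have w: "y n \<oplus> oexpw ?p \<odot> b < x n" .
      have "?p \<le> x (Suc n)" using xy unfolding Srel_def by simp
      \<comment> \<open>Being a multiple of omega^p above the start of block b, \<open>x n\<close>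
        must clear the whole block, contrary to the choice of b.\<close>
      then have "omult ?p (x n)" using Hset_omult[OF less.prems(1)] omult_trans by blast
      from oadd_oexpw_le[OF this w] show False using b(2) unfolding d by (simp add: oadd_assoc leD)
    qed
    then show "reach n a y x" using xy unfolding reach_def Srel_def by simp
  next
    assume r: "reach n a y x"
    have "\<exists>z\<in>Hset. Srel n x z \<and> Srel_pow n b z y" if b: "b < a" for b
    proof (cases "b = \<zero>")
      case True
      then show ?thesis using assms(2) reach_less[OF r less.prems(2)] r
        unfolding Srel_def by (auto simp: reach_def intro!: bexI[of _ y])
    next
      case False
      \<comment> \<open>The intermediate point is the least one from which y is b steps
        away.\<close>
      have z: "step n b y \<in> Hset" using assms(2) by (rule step_in_Hset)
      have "y n \<oplus> oexpw ?p \<odot> b < y n \<oplus> oexpw ?p \<odot> a" using b by (simp add: omul_less_iff)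
      also have "\<dots> \<le> x n" using r unfolding reach_def by blast
      finally have "y n \<oplus> oexpw ?p \<odot> b < x n" .
      then have "step n b y i < x i" if "i \<le> n" for i
        using r that by (intro step_less less.prems) (auto simp: reach_def)
      then have "Srel n x (step n b y)" using r unfolding Srel_def reach_def by simp
      moreover have "Srel_pow n b (step n b y) y"
        using less.IH[OF b z False] reach_iff_step[OF z] by simp
      ultimately show ?thesis using z by blast
    qed
    then show "Srel_pow n a x y" using Srel_pow_rec[OF less.prems(2)] by blast
  qed
qed

text \<open>Since a is nonzero, the value after b steps is strictly below \<open>x n\<close>; this
  strictness lets the rounded lower entries also stay below x.\<close>

lemma reach_step:
  assumes "x \<in> Hset" "a \<noteq> \<zero>"
  shows "reach n a (step n b y) x \<longleftrightarrow> reach n (b \<oplus> a) y x"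
proof
  assume "reach n a (step n b y) x"
  then show "reach n (b \<oplus> a) y x"
    unfolding reach_def by (auto simp: oadd_omul oadd_assoc intro: order_less_trans[OF step_below])
next
  assume r: "reach n (b \<oplus> a) y x"
  have "y n \<oplus> oexpw (y (Suc n)) \<odot> b < y n \<oplus> oexpw (y (Suc n)) \<odot> (b \<oplus> a)"
    using assms(2) oadd_less_iff[of b "\<zero>" a] by (simp add: omul_less_iff ozero_less_iff)
  also have "\<dots> \<le> x n" using r unfolding reach_def by blast
  finally have "y n \<oplus> oexpw (y (Suc n)) \<odot> b < x n" .
  then have "step n b y i < x i" if "i \<le> n" for i
    using r that by (intro step_less assms) (auto simp: reach_def)
  then show "reach n a (step n b y) x"
    using r unfolding reach_def by (simp add: oadd_omul oadd_assoc)
qed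

text \<open>\<open>x (Suc n)\<close> is at least \<open>y (Suc n) \<oplus> a\<close>, so
  \<open>x n\<close> is divisible by that power of omega and the strict inequality at n widens to a
  full block.\<close>

lemma reach_hexp:
  assumes "reach (Suc n) a y x" "a \<noteq> \<zero>" "x \<in> Hset"
  shows "reach n (hexp a) y x"
proof -
  have "y (Suc n) \<oplus> a \<le> y (Suc n) \<oplus> oexpw (y (Suc (Suc n))) \<odot> a"
    using omul_mono_left[OF oexpw_upper(1), of a] by simp
  also have "\<dots> \<le> x (Suc n)" using assms(1) unfolding reach_def by simp
  finally have "omult (y (Suc n) \<oplus> a) (x n)" using Hset_omult[OF assms(3)] omult_trans by blast
  moreover have "y n < x n" using assms(1) unfolding reach_def by simp
  ultimately have "y n \<oplus> oexpw (y (Suc n) \<oplus> a) \<le> x n" by (rule oadd_oexpw_le)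
  moreover have "\<forall>i>n. y i \<le> x i" using reach_le[OF assms(1)] unfolding le_fun_def by blast
  ultimately show ?thesis
    using assms(1) by (simp add: reach_def oexpw_oadd hexp_eq_oexpw[OF assms(2)])
qed

lemma reach_hexpn:
  assumes "reach (n + k) a y x" "a \<noteq> \<zero>" "x \<in> Hset"
  shows "reach n (hexpn k a) y x"
  using assms(1,2)
proof (induction k arbitrary: a)
  case (Suc k)
  then have "reach n (hexpn k (hexp a)) y x" using reach_hexp[OF _ _ assms(3)] by simp
  then show ?case by (simp add: funpow_swap1)
qed simp

subsection \<open>Forcing\<close>

definition cone :: "'o fml \<Rightarrow> (nat \<Rightarrow> 'o) \<Rightarrow> bool" where
  "cone \<phi> m \<longleftrightarrow> m \<in> Hset \<and> (\<forall>x\<in>Hset. forces x \<phi> \<longleftrightarrow> m \<le> x)"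

lemma forces_dia: "x \<in> Hset \<Longrightarrow> forces x (dia n (a::'o) \<phi>) \<longleftrightarrow> (\<exists>y\<in>Hset. Srel_pow n a x y \<and> forces y \<phi>)"
  by (auto simp: dia_def)

text \<open>\<open>reach\<close> is preserved when the end point is lowered, so it suffices to test
  the least point forcing \<phi>.\<close>

lemma forces_dia_iff:
  assumes "cone \<phi> m" "x \<in> Hset" "a \<noteq> \<zero>"
  shows "forces x (dia n a \<phi>) \<longleftrightarrow> reach n a m x"
  using assms Srel_pow_iff[of x _ a n] reach_antimono unfolding forces_dia[OF assms(2)] cone_def
  by (metis order_refl)

lemma cone_Top: "cone Top (\<lambda>_. \<zero>)"
  by (simp add: cone_def le_fun_def)

lemma cone_dia:
  assumes "cone \<phi> m" "a \<noteq> \<zero>"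
  shows "cone (dia n a \<phi>) (step n a m)"
proof -
  have "m \<in> Hset" using assms(1) by (simp add: cone_def)
  then show ?thesis unfolding cone_def[of "dia n a \<phi>"]
    by (simp add: step_in_Hset forces_dia_iff[OF assms(1) _ assms(2)] reach_iff_step)
qed

lemma forces_atom:
  assumes "x \<in> Hset"
  shows "forces x (dia n a Top) \<longleftrightarrow> a \<le> (x n :: 'o)"
proof (cases "a = \<zero>")
  case False
  have "\<zero> < x i" if "a \<le> x n" "i < n" for i
  proof -
    have "x n \<noteq> \<zero>" using that False by auto
    then show ?thesis using Hset_nonzero[OF assms] that by (simp add: ozero_less_iff less_imp_le)
  qed
  then show ?thesis by (auto simp: forces_dia_iff[OF cone_Top assms False] reach_def)
qed (simp add: dia_def)

text \<open>A least upper bound in H once a dominates b from k on, which is why the tail is copied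
  from a alone.\<close>

definition join :: "nat \<Rightarrow> (nat \<Rightarrow> 'o) \<Rightarrow> (nat \<Rightarrow> 'o) \<Rightarrow> nat \<Rightarrow> 'o" where
  "join k a b = fill k a (\<lambda>i. max (a i) (b i))"

lemma join_in_Hset:
  assumes "a \<in> Hset"
  shows "join k a b \<in> Hset"
proof -
  obtain j where "a j = \<zero>" using assms by (auto simp: Hset_iff)
  then have "a (max j k) = \<zero>" using assms Hset_zero_mono max.cobounded1 by blast
  then show ?thesis unfolding join_def using Hset_ologd[OF assms]
    by (intro fill_in_Hset[of _ _ "max j k"]) auto
qed

lemma join_le_iff:
  assumes "x \<in> Hset" "\<And>i. k \<le> i \<Longrightarrow> b i \<le> a i"
  shows "join k a b \<le> x \<longleftrightarrow> a \<le> x \<and> b \<le> x"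
proof
  assume "join k a b \<le> x"
  then have j: "join k a b i \<le> x i" for i by (rule le_funD)
  have "max (a i) (b i) \<le> join k a b i" for i
    unfolding join_def using fill_ge[of i k "\<lambda>i. max (a i) (b i)"] fill_same[of k i] assms(2)[of i]
    by (cases "i < k") auto
  with j show "a \<le> x \<and> b \<le> x" unfolding le_fun_def by (meson max.boundedE order_trans)
next
  assume "a \<le> x \<and> b \<le> x"
  then show "join k a b \<le> x"
    unfolding join_def le_fun_def by (intro allI fill_least assms) auto
qed

lemma cone_Conj:
  assumes "cone \<phi> a" "cone \<psi> b" "\<And>i. k \<le> i \<Longrightarrow> b i \<le> a i"
  shows "cone (Conj \<phi> \<psi>) (join k a b)"
  using assms join_le_iff[OF _ assms(3)] unfolding cone_def by (simp add: join_in_Hset)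

lemma Hset_eventually_le:
  assumes "b \<in> Hset"
  obtains k where "\<And>i. k \<le> i \<Longrightarrow> b i \<le> (a i :: 'o)"
  using assms Hset_zero_mono unfolding Hset_iff by (metis (no_types) assms ozero_le)

subsection \<open>Derivable closure of conjunctions of atoms\<close>

text \<open>The mixing rule lets \<open>\<langle>n+1\<^sup>q\<rangle>\<top>\<close> absorb \<open>\<langle>n\<^sup>c\<rangle>\<top>\<close>, and reducing the former to level \<open>n\<close> then adds
\<open>\<omega>\<^sup>q\<close> to \<open>c\<close>; this reaches the next multiple of \<open>\<omega>\<^sup>q\<close> above \<open>c\<close>.\<close>

lemma tsc_rd:
  assumes c: "\<chi> \<turnstile>\<^sub>T dia n c Top" and q: "\<chi> \<turnstile>\<^sub>T dia (Suc n) q Top"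
  shows "\<chi> \<turnstile>\<^sub>T dia n (rd q (c::'o)) Top"
proof -
  obtain h r where hr: "c = oexpw q \<odot> h \<oplus> r" "r < oexpw q" by (rule odivE[OF oexpw_ne_zero])
  let ?d = "oexpw q \<odot> h"
  consider "q = \<zero>" | "c = \<zero>" | "c \<noteq> \<zero>" "r = \<zero>" | "q \<noteq> \<zero>" "r \<noteq> \<zero>" by blast
  then show ?thesis
  proof cases
    case 1
    then have "rd q c \<le> c" by (simp add: rd_least)
    with c show ?thesis by (rule tsc_atom_le)
  next
    case 2
    \<comment> \<open>For c zero, reduction from level n + 1 alone supplies the rounded
      value.\<close>
    then have "rd q c \<le> hexp q" by (intro rd_least) (auto simp: le_ologd)
    with tsc_hexp[OF q] show ?thesis by (rule tsc_atom_le)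
  next
    case 3
    then have "rd q c \<le> c" using hr by (intro rd_least) (auto simp: le_ologd omult_def)
    with c show ?thesis by (rule tsc_atom_le)
  next
    case 4
    \<comment> \<open>Mixing accepts only successor exponents, so c is first weakened to the
      successor of the multiple below it.\<close>
    have "?d \<oplus> \<one> \<le> c" using 4 hr by (simp add: oone_le_iff)
    with c have "\<chi> \<turnstile>\<^sub>T dia n (?d \<oplus> \<one>) Top" by (rule tsc_atom_le)
    with q have "\<chi> \<turnstile>\<^sub>T Conj (dia (Suc n) q Top) (dia n (?d \<oplus> \<one>) Top)" by (rule r_conj)
    also have "\<dots> \<turnstile>\<^sub>T dia (Suc n) q (Conj Top (dia n (?d \<oplus> \<one>) Top))"
      by (intro r_mix ax_refl) auto
    also have "\<dots> \<turnstile>\<^sub>T dia (Suc n) q (dia n (?d \<oplus> \<one>) Top)"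
      by (intro r_nec ax_conjR) auto
    finally have "\<chi> \<turnstile>\<^sub>T dia n (hexp q) (dia n (?d \<oplus> \<one>) Top)"
      by (rule tsc_hexp)
    also have "\<dots> \<turnstile>\<^sub>T dia n (?d \<oplus> \<one> \<oplus> hexp q) Top"
      by (rule ax_add2) simp
    finally have *: "\<chi> \<turnstile>\<^sub>T dia n (?d \<oplus> \<one> \<oplus> hexp q) Top" .
    \<comment> \<open>The added one is absorbed, leaving exactly the next multiple.\<close>
    have "\<one> < oexpw q" using 4 oexpw_less_iff[of "\<zero>" q] by (simp add: ozero_less_iff)
    then have "?d \<oplus> \<one> \<oplus> hexp q = ?d \<oplus> oexpw q"
      using 4 by (simp add: oadd_assoc hexp_eq_oexpw less_oexpw_oadd)
    moreover have "rd q c \<le> ?d \<oplus> oexpw q"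
      using hr omult_oadd[of q "?d" \<one>]
      by (intro rd_least) (auto simp: le_ologd omult_def less_imp_le)
    ultimately show ?thesis using * tsc_atom_le by metis
  qed
qed

lemma tsc_fill:
  assumes "\<And>i. k \<le> i \<Longrightarrow> \<chi> \<turnstile>\<^sub>T dia i (u i) Top" "\<And>i. i < k \<Longrightarrow> \<chi> \<turnstile>\<^sub>T dia i (c i) Top"
  shows "\<chi> \<turnstile>\<^sub>T dia i (fill k u c i :: 'o) Top"
  using assms
proof (induction k arbitrary: u)
  case (Suc k)
  show ?case unfolding fill.simps
  proof (rule Suc.IH)
    fix i assume "k \<le> i"
    then show "\<chi> \<turnstile>\<^sub>T dia i ((u(k := rd (u (Suc k)) (c k))) i) Top"
      using Suc.prems by (cases "i = k") (auto intro: tsc_rd)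
  qed (use Suc.prems in auto)
qed simp

text \<open>The syntactic counterpart of \<open>cone\<close>: modulo derivability, \<open>\<phi>\<close> is the infinite conjunction of
the atoms given by \<open>m\<close>.\<close>

definition tsc_cone :: "'o fml \<Rightarrow> (nat \<Rightarrow> 'o) \<Rightarrow> bool" where
  "tsc_cone \<phi> m \<longleftrightarrow> (\<forall>\<chi>. wff \<chi> \<longrightarrow> (\<chi> \<turnstile>\<^sub>T \<phi> \<longleftrightarrow> (\<forall>i. \<chi> \<turnstile>\<^sub>T dia i (m i) Top)))"

lemma tsc_cone_Top: "tsc_cone Top (\<lambda>_. \<zero>)"
  by (simp add: tsc_cone_def)

lemma tsc_cone_Conj:
  assumes "tsc_cone \<phi> a" "tsc_cone \<psi> b" "\<And>i. k \<le> i \<Longrightarrow> b i \<le> a i"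
  shows "tsc_cone (Conj \<phi> \<psi>) (join k a b)"
  unfolding tsc_cone_def
proof (intro allI impI)
  fix \<chi> :: "'o fml" assume "wff \<chi>"
  then have "\<chi> \<turnstile>\<^sub>T Conj \<phi> \<psi> \<longleftrightarrow> (\<forall>i. \<chi> \<turnstile>\<^sub>T dia i (a i) Top) \<and> (\<forall>i. \<chi> \<turnstile>\<^sub>T dia i (b i) Top)"
    using assms unfolding tsc_cone_def tsc_Conj_iff by blast
  also have "\<dots> \<longleftrightarrow> (\<forall>i. \<chi> \<turnstile>\<^sub>T dia i (join k a b i) Top)"
  proof
    assume "(\<forall>i. \<chi> \<turnstile>\<^sub>T dia i (a i) Top) \<and> (\<forall>i. \<chi> \<turnstile>\<^sub>T dia i (b i) Top)"
    then show "\<forall>i. \<chi> \<turnstile>\<^sub>T dia i (join k a b i) Top"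
      unfolding join_def by (auto intro!: tsc_fill simp: max_def)
  next
    assume *: "\<forall>i. \<chi> \<turnstile>\<^sub>T dia i (join k a b i) Top"
    have "a i \<le> join k a b i \<and> b i \<le> join k a b i" for i
      using fill_ge[of i k "\<lambda>i. max (a i) (b i)"] fill_same[of k i] assms(3)[of i]
      unfolding join_def by (cases "i < k") auto
    with * show "(\<forall>i. \<chi> \<turnstile>\<^sub>T dia i (a i) Top) \<and> (\<forall>i. \<chi> \<turnstile>\<^sub>T dia i (b i) Top)"
      using tsc_atom_le by blast
  qed
  finally show "\<chi> \<turnstile>\<^sub>T Conj \<phi> \<psi> \<longleftrightarrow> (\<forall>i. \<chi> \<turnstile>\<^sub>T dia i (join k a b i) Top)" .
qed

subsection \<open>Modal steps\<close>

lemma mono_conj_Cons2: "mono_conj ((n, a) # (n0, a0) # xs) = Conj (dia n a Top) (mono_conj ((n0, a0) # xs))"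
  by simp

text \<open>The atoms of y from level m on amount to a monomial normal form: an entry equal to the
  hyper-exponential of the next one is derivable by reduction and dropped, all other nonzero entries
  are kept. The induction runs down from a level where y vanishes.\<close>

lemma mnf_tail:
  assumes "y \<in> Hset" "y (m + d) = \<zero>" "y m \<noteq> (\<zero>::'o)"
  shows "\<exists>n0 a0 xs. m \<le> n0 \<and> mnf_list ((n0, a0) # xs) \<and> y m = hexpn (n0 - m) a0 \<and>
    (\<forall>\<chi>. wff \<chi> \<longrightarrow> (\<chi> \<turnstile>\<^sub>T mono_conj ((n0, a0) # xs) \<longleftrightarrow> (\<forall>i\<ge>m. \<chi> \<turnstile>\<^sub>T dia i (y i) Top)))"
  using assms(2,3)
proof (induction d arbitrary: m)
  case (Suc d)
  have split: "(\<forall>i\<ge>m. P i) \<longleftrightarrow> P m \<and> (\<forall>i\<ge>Suc m. P i)" for P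
    by (metis Suc_leD Suc_leI order_le_less order_refl)
  show ?case
  proof (cases "y (Suc m) = \<zero>")
    case True
    then have "y i = \<zero>" if "i \<ge> Suc m" for i using Hset_zero_mono[OF assms(1) _ that] by blast
    then have "\<chi> \<turnstile>\<^sub>T mono_conj [(m, y m)] \<longleftrightarrow> (\<forall>i\<ge>m. \<chi> \<turnstile>\<^sub>T dia i (y i) Top)" if "wff \<chi>" for \<chi>
      unfolding split using that by (simp add: ax_top)
    then show ?thesis using Suc.prems
      by (intro exI[of _ m] exI[of _ "y m"] exI[of _ "[]"]) (auto intro: mnf_single simp: ozero_less_iff)
  next
    case False
    then obtain n0 a0 xs where IH: "Suc m \<le> n0" "mnf_list ((n0, a0) # xs)"
      "y (Suc m) = hexpn (n0 - Suc m) a0"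
      "\<And>\<chi>. wff \<chi> \<Longrightarrow> \<chi> \<turnstile>\<^sub>T mono_conj ((n0, a0) # xs) \<longleftrightarrow> (\<forall>i\<ge>Suc m. \<chi> \<turnstile>\<^sub>T dia i (y i) Top)"
      using Suc.IH[of "Suc m"] Suc.prems by auto
    have "n0 - m = Suc (n0 - Suc m)" using IH(1) by simp
    then have hex: "hexpn (n0 - m) a0 = hexp (y (Suc m))" by (simp add: IH(3))
    obtain g where g: "y m = oexpw (y (Suc m)) \<odot> g" using Hset_omult[OF assms(1)] unfolding omult_def by blast
    then have g0: "g \<noteq> \<zero>" using Suc.prems by auto
    show ?thesis
    proof (cases "g = \<one>")
      case True
      then have ym: "y m = hexp (y (Suc m))" using g False by (simp add: hexp_eq_oexpw)
      have "\<chi> \<turnstile>\<^sub>T dia m (y m) Top" if "\<forall>i\<ge>Suc m. \<chi> \<turnstile>\<^sub>T dia i (y i) Top" for \<chi>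
        unfolding ym using that by (simp add: tsc_hexp)
      then show ?thesis using IH hex ym unfolding split
        by (intro exI[of _ n0] exI[of _ a0] exI[of _ xs]) auto
    next
      case False': False
      \<comment> \<open>A quotient other than zero and one is at least two, matching the factor in
        the definition of normal forms.\<close>
      with g0 have "otwo \<le> g" unfolding otwo_def osuc_le_iff
        by (metis oone_le_iff order_le_less)
      then obtain d where "g = otwo \<oplus> d" by (rule le_oaddE)
      then have "mnf_list ((m, y m) # (n0, a0) # xs)"
        using g IH False hex by (intro mnf_cons[where d = d]) (auto simp: hexp_eq_oexpw)
      moreover have "\<chi> \<turnstile>\<^sub>T mono_conj ((m, y m) # (n0, a0) # xs) \<longleftrightarrow> (\<forall>i\<ge>m. \<chi> \<turnstile>\<^sub>T dia i (y i) Top)"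
        if "wff \<chi>" for \<chi>
        unfolding split mono_conj_Cons2 tsc_Conj_iff using IH(4)[OF that] by blast
      ultimately show ?thesis
        by (intro exI[of _ m] exI[of _ "y m"] exI[of _ "(n0, a0) # xs"]) auto
    qed
  qed
qed simp

text \<open>The case \<open>a = \<zero>\<close> says that \<open>\<theta>\<close> is the conjunction of the atoms of \<open>y\<close> at level at least \<open>n\<close>.\<close>

lemma tsc_dia_tail:
  assumes y: "y \<in> Hset"
  obtains \<theta> where "\<And>\<chi> a. wff \<chi> \<Longrightarrow> \<chi> \<turnstile>\<^sub>T dia n a \<theta> \<longleftrightarrow>
    \<chi> \<turnstile>\<^sub>T dia n (y n \<oplus> oexpw (y (Suc n)) \<odot> a) Top \<and> (\<forall>i>n. \<chi> \<turnstile>\<^sub>T dia i (y i :: 'o) Top)"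
proof (cases "y (Suc n) = \<zero>")
  case True
  then have 0: "y i = \<zero>" if "n < i" for i using Hset_zero_mono[OF y] that by (metis Suc_leI)
  have "\<chi> \<turnstile>\<^sub>T dia n a (dia n (y n) Top) \<longleftrightarrow> \<chi> \<turnstile>\<^sub>T dia n (y n \<oplus> a) Top" for \<chi> a
    by (rule tsc_add_iff) simp
  then show thesis by (intro that[of "dia n (y n) Top"]) (simp add: True 0 ax_top)
next
  case False
  obtain j where "y j = \<zero>" using y by (auto simp: Hset_iff)
  then have "y (Suc n + j) = \<zero>" using Hset_zero_mono[OF y] by (metis le_add2)
  from mnf_tail[OF y this False] obtain n0 a0 xs where
    t: "Suc n \<le> n0" "mnf_list ((n0, a0) # xs)" "y (Suc n) = hexpn (n0 - Suc n) a0"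
    "\<And>\<chi>. wff \<chi> \<Longrightarrow> \<chi> \<turnstile>\<^sub>T mono_conj ((n0, a0) # xs) \<longleftrightarrow> (\<forall>i\<ge>Suc n. \<chi> \<turnstile>\<^sub>T dia i (y i) Top)"
    by blast
  let ?M = "mono_conj ((n0, a0) # xs)"
  have "n0 - n = Suc (n0 - Suc n)" using t(1) by simp
  then have hex: "hexpn (n0 - n) a0 = oexpw (y (Suc n))"
    using False by (simp add: hexp_eq_oexpw flip: t(3))
  obtain g where g: "y n = oexpw (y (Suc n)) \<odot> g" using Hset_omult[OF y] unfolding omult_def by blast
  have "y n \<noteq> \<zero>" using Hset_nonzero[OF y False] by simp
  with g have "\<one> \<le> g" by (auto simp: oone_le_iff)
  \<comment> \<open>The normal form already accounts for one block at level n, so \<open>g'\<close>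
    iterations produce \<open>y n\<close>, and a further a iterations add the remaining
    blocks.\<close>
  then obtain g' where g': "g = \<one> \<oplus> g'" by (rule le_oaddE)
  show thesis
  proof (rule that)
    fix \<chi> :: "'o fml" and a assume \<chi>: "wff \<chi>"
    let ?c = "hexpn (n0 - n) a0 \<odot> (\<one> \<oplus> (g' \<oplus> a))"
    have c: "y n \<oplus> oexpw (y (Suc n)) \<odot> a = ?c"
      unfolding hex by (simp add: g g' oadd_omul oadd_assoc)
    have "\<chi> \<turnstile>\<^sub>T dia n a (dia n g' ?M) \<longleftrightarrow> \<chi> \<turnstile>\<^sub>T dia n (g' \<oplus> a) ?M"
      by (rule tsc_add_iff) simp
    also have "\<dots> \<longleftrightarrow> \<chi> \<turnstile>\<^sub>T mono_conj ((n, ?c) # (n0, a0) # xs)"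
      using t by (intro tsc_equiv ax_mnf1 ax_mnf2) auto
    also have "\<dots> \<longleftrightarrow> \<chi> \<turnstile>\<^sub>T dia n ?c Top \<and> \<chi> \<turnstile>\<^sub>T ?M"
      unfolding mono_conj_Cons2 tsc_Conj_iff ..
    finally show "\<chi> \<turnstile>\<^sub>T dia n a (dia n g' ?M) \<longleftrightarrow>
      \<chi> \<turnstile>\<^sub>T dia n (y n \<oplus> oexpw (y (Suc n)) \<odot> a) Top \<and> (\<forall>i>n. \<chi> \<turnstile>\<^sub>T dia i (y i) Top)"
      unfolding c t(4)[OF \<chi>] Suc_le_eq .
  qed
qed

text \<open>One direction derives lower bounds level by level and closes them with
  \<open>tsc_fill\<close>. The other rebuilds a formula under the modality that derives every atom
  of m, and hence \<phi>.\<close>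

lemma tsc_cone_dia:
  assumes m: "m \<in> Hset" and \<phi>: "wff \<phi>" "tsc_cone \<phi> m" and a: "a \<noteq> \<zero>"
  shows "tsc_cone (dia n a \<phi>) (step n a m)"
  unfolding tsc_cone_def
proof (intro allI impI iffI)
  have at: "\<phi> \<turnstile>\<^sub>T dia i (m i) Top" for i using \<phi> ax_refl unfolding tsc_cone_def by blast
  \<comment> \<open>Reduction leaves a nonzero exponent at level i, hence at least one step beyond
    \<open>m i\<close>.\<close>
  have below: "dia n a \<phi> \<turnstile>\<^sub>T dia i (osuc (m i)) Top" if "i < n" for i
  proof -
    have "dia n a \<phi> \<turnstile>\<^sub>T dia i (hexpn (n - i) a) \<phi>"
      using ax_red[OF \<phi>(1), of i "n - i" a] that by simp
    also have "\<dots> \<turnstile>\<^sub>T dia i \<one> \<phi>" using \<phi> a by (intro tsc_le) (auto simp: oone_le_iff)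
    also have "\<dots> \<turnstile>\<^sub>T dia i \<one> (dia i (m i) Top)" by (rule r_nec[OF at])
    also have "\<dots> \<turnstile>\<^sub>T dia i (m i \<oplus> \<one>) Top" by (rule ax_add2) simp
    finally show ?thesis by (simp add: oadd_one)
  qed
  obtain \<theta> where \<theta>: "\<And>\<chi> a. wff \<chi> \<Longrightarrow> \<chi> \<turnstile>\<^sub>T dia n a \<theta> \<longleftrightarrow>
      \<chi> \<turnstile>\<^sub>T dia n (m n \<oplus> oexpw (m (Suc n)) \<odot> a) Top \<and> (\<forall>i>n. \<chi> \<turnstile>\<^sub>T dia i (m i) Top)"
    using tsc_dia_tail[OF m] by metis
  have "\<phi> \<turnstile>\<^sub>T \<theta>" using \<theta>[OF \<phi>(1), of \<zero>] at by simp
  then have up: "dia n a \<phi> \<turnstile>\<^sub>T dia n (m n \<oplus> oexpw (m (Suc n)) \<odot> a) Top"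
    "n < i \<Longrightarrow> dia n a \<phi> \<turnstile>\<^sub>T dia i (m i) Top" for i
    using \<theta>[of "dia n a \<phi>" a] r_nec \<phi>(1) by auto
  fix \<chi> :: "'o fml" assume \<chi>: "wff \<chi>"
  {
    assume "\<chi> \<turnstile>\<^sub>T dia n a \<phi>"
    fix i
    have "dia n a \<phi> \<turnstile>\<^sub>T dia i (step n a m i) Top"
      unfolding step_def
      using below up by (intro tsc_fill) (auto simp: le_less)
    with \<open>\<chi> \<turnstile>\<^sub>T dia n a \<phi>\<close> show "\<chi> \<turnstile>\<^sub>T dia i (step n a m i) Top" by (rule r_cut)
  }
  assume st: "\<forall>i. \<chi> \<turnstile>\<^sub>T dia i (step n a m i) Top"
  \<comment> \<open>Starting from the tail formula, mixing inserts the missing atoms under the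
    modality at levels n - 1, n - 2 and so on.\<close>
  have "\<exists>\<theta>. \<chi> \<turnstile>\<^sub>T dia n a \<theta> \<and> (\<forall>i\<ge>n - k. \<theta> \<turnstile>\<^sub>T dia i (m i) Top)" for k
  proof (induction k)
    case 0
    have "\<chi> \<turnstile>\<^sub>T dia n a \<theta>" using st unfolding \<theta>[OF \<chi>] by (metis step_above step_at)
    moreover have "wff \<theta>" using calculation tsc_wff by fastforce
    then have "\<theta> \<turnstile>\<^sub>T dia i (m i) Top" if "n \<le> i" for i
      using \<theta>[of \<theta> \<zero>] ax_refl that by (cases "i = n") auto
    ultimately show ?case by auto
  next
    case (Suc k)
    then obtain \<theta> where \<theta>: "\<chi> \<turnstile>\<^sub>T dia n a \<theta>" "\<forall>i\<ge>n - k. \<theta> \<turnstile>\<^sub>T dia i (m i) Top" by blast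
    then have wff: "wff \<theta>" using tsc_wff by fastforce
    show ?case
    proof (cases "k < n")
      case True
      let ?j = "n - Suc k"
      \<comment> \<open>The successor exponent required by mixing is available because
        \<open>step\<close> strictly raises every entry below n.\<close>
      let ?\<alpha> = "dia ?j (m ?j \<oplus> \<one>) Top"
      have j: "?j < n" "n - k = Suc ?j" using True by auto
      have "\<chi> \<turnstile>\<^sub>T ?\<alpha>" unfolding oadd_one
        by (rule tsc_atom_le[OF st[rule_format]]) (use step_below[OF j(1)] in \<open>simp add: osuc_le_iff\<close>)
      with \<theta>(1) have "\<chi> \<turnstile>\<^sub>T Conj (dia n a \<theta>) ?\<alpha>" by (rule r_conj)
      also have "\<dots> \<turnstile>\<^sub>T dia n a (Conj \<theta> ?\<alpha>)" using wff j by (intro r_mix ax_top)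
      finally have "\<chi> \<turnstile>\<^sub>T dia n a (Conj \<theta> ?\<alpha>)" .
      moreover have "Conj \<theta> ?\<alpha> \<turnstile>\<^sub>T dia i (m i) Top" if "?j \<le> i" for i
      proof (cases "i = ?j")
        case True
        have "Conj \<theta> ?\<alpha> \<turnstile>\<^sub>T ?\<alpha>" using wff by (intro ax_conjR) auto
        then show ?thesis unfolding True by (rule tsc_atom_le) simp
      next
        case False
        then have "n - k \<le> i" using that j by simp
        then show ?thesis using \<theta>(2) ax_conjL[OF wff, of ?\<alpha>] r_cut by auto
      qed
      ultimately show ?thesis by blast
    qed (use \<theta> in auto)
  qed
  from this[of n] obtain \<theta> where \<theta>: "\<chi> \<turnstile>\<^sub>T dia n a \<theta>" "\<forall>i. \<theta> \<turnstile>\<^sub>T dia i (m i) Top" by auto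
  then have "\<theta> \<turnstile>\<^sub>T \<phi>" using \<phi>(2) tsc_wff wff_dia unfolding tsc_cone_def by metis
  then show "\<chi> \<turnstile>\<^sub>T dia n a \<phi>" using \<theta>(1) r_nec r_cut by metis
qed

lemma ex_cones: "wff \<phi> \<Longrightarrow> \<exists>m. cone \<phi> m \<and> tsc_cone \<phi> m"
proof (induction \<phi>)
  case Top
  then show ?case using cone_Top tsc_cone_Top by blast
next
  case (Conj \<phi> \<psi>)
  then obtain a b where ab: "cone \<phi> a" "tsc_cone \<phi> a" "cone \<psi> b" "tsc_cone \<psi> b" by auto
  then have "b \<in> Hset" by (simp add: cone_def)
  then obtain k where "\<And>i. k \<le> i \<Longrightarrow> b i \<le> a i" using Hset_eventually_le by blast
  with ab show ?case using cone_Conj tsc_cone_Conj by blast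
next
  case (Dia n a \<phi>)
  then obtain m where m: "cone \<phi> m" "tsc_cone \<phi> m" by auto
  then have "m \<in> Hset" by (simp add: cone_def)
  with m Dia.prems show ?case
    using cone_dia[of \<phi> m a n] tsc_cone_dia[of m \<phi> a n] by (auto simp: dia_def)
qed

subsection \<open>Soundness\<close>

lemma hexpn_le:
  assumes "x \<in> Hset"
  shows "hexpn k (x (i + k)) \<le> (x i :: 'o)"
proof (induction k arbitrary: i)
  case (Suc k)
  have "hexp (hexpn k (x (Suc i + k))) \<le> hexp (x (Suc i))" by (intro hexp_mono Suc.IH)
  also have "\<dots> \<le> x i" by (intro hexp_le Hset_ologd assms)
  finally show ?case by simp
qed simp

text \<open>Adds the atom of exponent a at level n to y; the iterated hyper-exponentials are the
  least entries this forces at lower levels.\<close>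

lemma Hset_raise:
  assumes y: "y \<in> Hset" "y (Suc n) \<le> ologd a" "\<And>i. i \<le> n \<Longrightarrow> y i \<le> hexpn (n - i) (a::'o)"
  obtains z where "z \<in> Hset" "\<And>i. i \<le> n \<Longrightarrow> z i = hexpn (n - i) a"
    "\<And>x. x \<in> Hset \<Longrightarrow> z \<le> x \<longleftrightarrow> a \<le> x n \<and> y \<le> x"
proof
  define z where "z i = (if i \<le> n then hexpn (n - i) a else y i)" for i
  have "z (Suc i) \<le> ologd (z i)" for i
  proof (cases "i < n")
    case True
    then have "n - i = Suc (n - Suc i)" by simp
    then show ?thesis using True unfolding z_def by (simp add: le_ologd)
  qed (use y Hset_ologd[OF y(1), of i] in \<open>auto simp: z_def not_less le_less\<close>)
  moreover obtain j where "y j = \<zero>" using y(1) by (auto simp: Hset_iff)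
  then have "y (max j (Suc n)) = \<zero>" using y(1) Hset_zero_mono max.cobounded1 by blast
  then have "z (max j (Suc n)) = \<zero>" by (auto simp: z_def)
  ultimately show "z \<in> Hset" unfolding Hset_iff by blast
  show "z i = hexpn (n - i) a" if "i \<le> n" for i using that by (simp add: z_def)
  fix x :: "nat \<Rightarrow> 'o" assume x: "x \<in> Hset"
  show "z \<le> x \<longleftrightarrow> a \<le> x n \<and> y \<le> x"
  proof
    assume zx: "z \<le> x"
    have "y \<le> z" unfolding le_fun_def z_def using y(3) by simp
    then show "a \<le> x n \<and> y \<le> x" using zx le_funD[OF zx, of n] by (auto simp: z_def)
  next
    assume *: "a \<le> x n \<and> y \<le> x"
    have "hexpn (n - i) a \<le> x i" if "i \<le> n" for i
    proof -
      have "hexpn (n - i) a \<le> hexpn (n - i) (x (i + (n - i)))"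
        using * that by (intro hexpn_mono) simp
      also have "\<dots> \<le> x i" by (rule hexpn_le[OF x])
      finally show ?thesis .
    qed
    then show "z \<le> x" using * unfolding le_fun_def z_def by simp
  qed
qed

text \<open>Besides existence, the induction records that the least point consists of pure
  hyper-exponentials up to the leading level; soundness of the normal form axiom needs this
  shape.\<close>

lemma mnf_cone_aux:
  "mnf_list xs \<Longrightarrow> xs \<noteq> [] \<Longrightarrow> snd (hd xs) \<noteq> (\<zero>::'o) \<and>
    (\<exists>y. cone (mono_conj xs) y \<and> (\<forall>i\<le>fst (hd xs). y i = hexpn (fst (hd xs) - i) (snd (hd xs))))"
proof (induction rule: mnf_list.induct)
  case (mnf_single a n)
  obtain z where "z \<in> Hset" "\<And>i. i \<le> n \<Longrightarrow> z i = hexpn (n - i) a"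
    "\<And>x. x \<in> Hset \<Longrightarrow> z \<le> x \<longleftrightarrow> a \<le> x n \<and> (\<lambda>_. \<zero>) \<le> x"
    by (rule Hset_raise[of "\<lambda>_. \<zero>" n a]) simp_all
  then show ?case using mnf_single
    by (intro conjI exI[of _ z]) (auto simp: cone_def forces_atom le_fun_def)
next
  case (mnf_cons n0 a0 xs n a d)
  then obtain y where y: "a0 \<noteq> \<zero>" "cone (mono_conj ((n0, a0) # xs)) y"
    "\<forall>i\<le>n0. y i = hexpn (n0 - i) a0" by auto
  have "n0 - n = Suc (n0 - Suc n)" using mnf_cons by simp
  then have hex: "hexpn (n0 - n) a0 = oexpw (y (Suc n))"
    using y(1) y(3)[rule_format, of "Suc n"] mnf_cons by (simp add: hexp_eq_oexpw)
  have "otwo \<oplus> d \<noteq> (\<zero>::'o)" by (simp add: otwo_def)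
  then have a: "a = oexpw (y (Suc n)) \<odot> (otwo \<oplus> d)" "a \<noteq> \<zero>" "\<one> \<le> otwo \<oplus> d"
    using mnf_cons hex by (auto simp: oone_le_iff)
  have log: "y (Suc n) \<le> ologd a" using a by (auto simp: le_ologd omult_def)
  have le: "y i \<le> hexpn (n - i) a" if "i \<le> n" for i
  proof -
    have "y i = hexpn ((n - i) + (n0 - n)) a0" using y(3) that mnf_cons by simp
    also have "\<dots> = hexpn (n - i) (oexpw (y (Suc n)))" unfolding funpow_add comp_def hex ..
    also have "\<dots> \<le> hexpn (n - i) a" unfolding a(1)
      using omul_mono_right[OF a(3)] by (intro hexpn_mono) simp
    finally show ?thesis .
  qed
  have yH: "y \<in> Hset" using y(2) by (simp add: cone_def)
  obtain z where "z \<in> Hset" "\<And>i. i \<le> n \<Longrightarrow> z i = hexpn (n - i) a"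
    "\<And>x. x \<in> Hset \<Longrightarrow> z \<le> x \<longleftrightarrow> a \<le> x n \<and> y \<le> x"
    using Hset_raise[OF yH log le] by blast
  then show ?case using y(2) a(2)
    by (intro conjI exI[of _ z]) (simp_all add: cone_def forces_atom)
qed simp

lemma mnf_cone:
  assumes "mnf_list ((n0, a0) # xs)"
  obtains y where "cone (mono_conj ((n0, a0) # xs)) y" "a0 \<noteq> \<zero>" "\<forall>i\<le>n0. y i = hexpn (n0 - i) (a0::'o)"
  using mnf_cone_aux[OF assms] by auto

text \<open>Here omega^\<open>y (Suc n)\<close> equals \<open>y n\<close>, so the exponent on the
  right is \<open>y n \<oplus> y n \<odot> a\<close>, precisely the bound in
  \<open>reach\<close>.\<close>

lemma forces_mnf:
  assumes mnf: "mnf_list ((n0, a0) # xs)" and n: "n < n0" and x: "x \<in> Hset"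
  shows "forces x (dia n a (mono_conj ((n0, a0) # xs))) \<longleftrightarrow>
    forces x (mono_conj ((n, hexpn (n0 - n) a0 \<odot> (\<one> \<oplus> (a::'o))) # (n0, a0) # xs))" (is "?l \<longleftrightarrow> ?r")
proof -
  obtain y where y: "cone (mono_conj ((n0, a0) # xs)) y" "a0 \<noteq> \<zero>" "\<forall>i\<le>n0. y i = hexpn (n0 - i) a0"
    using mnf by (rule mnf_cone)
  have yi: "y i = hexp (y (Suc i))" if "i \<le> n" for i
  proof -
    have "n0 - i = Suc (n0 - Suc i)" using n that by simp
    then show ?thesis using y(3) n that by simp
  qed
  have "y (Suc n) \<noteq> \<zero>" using y(2) y(3) n by simp
  then have yn: "oexpw (y (Suc n)) = y n" using yi[of n] by (simp add: hexp_eq_oexpw)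
  have "?r \<longleftrightarrow> y n \<oplus> y n \<odot> a \<le> x n \<and> y \<le> x"
    using y(1) y(3) n x by (simp add: cone_def forces_atom oadd_omul)
  also have "\<dots> \<longleftrightarrow> ?l"
  proof (cases "a = \<zero>")
    case True
    then show ?thesis using y(1) x le_funD[of y x n] by (auto simp: cone_def)
  next
    case False
    \<comment> \<open>Strictness at n passes downward because \<open>hexp\<close> is strictly
      increasing and \<open>hexp (x (Suc i))\<close> is at most \<open>x i\<close>.\<close>
    have "y i < x i" if yx: "y n \<oplus> y n \<odot> a \<le> x n" and "i \<le> n" for i
      using \<open>i \<le> n\<close>
    proof (induction i rule: inc_induct)
      case base
      have "y n \<oplus> \<zero> < y n \<oplus> y n \<odot> a"
        by (subst oadd_less_iff) (use False in \<open>simp add: ozero_less_iff flip: yn\<close>)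
      with yx show ?case by simp
    next
      case (step i)
      have "y i < hexp (x (Suc i))" using step by (simp add: yi hexp_strict)
      also have "\<dots> \<le> x i" using x by (intro hexp_le Hset_ologd)
      finally show ?case .
    qed
    then show ?thesis
      using reach_le[of n a y x] unfolding forces_dia_iff[OF y(1) x False]
      by (auto simp: reach_def yn le_fun_def)
  qed
  finally show ?thesis by simp
qed

lemma forces_dia_dia:
  assumes "wff \<phi>" "x \<in> Hset"
  shows "forces x (dia n a (dia n b \<phi>)) \<longleftrightarrow> forces x (dia n (b \<oplus> a :: 'o) \<phi>)"
proof -
  obtain m where m: "cone \<phi> m" using ex_cones[OF assms(1)] by blast
  show ?thesis
  proof (cases "a = \<zero> \<or> b = \<zero>")
    case False
    then show ?thesis
      using forces_dia_iff[OF cone_dia[OF m] assms(2)] forces_dia_iff[OF m assms(2)]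
        reach_step[OF assms(2)] by simp
  qed auto
qed

text \<open>The witness is the join of the least points of \<phi> and of the lower modal formula;
  the work lies in keeping it strictly below x at levels up to m.\<close>

lemma forces_mix:
  assumes \<phi>: "cone \<phi> y" and \<psi>: "cone \<psi> w" and wy: "w \<le> y" and "m < n"
    and x: "x \<in> Hset" and "forces x (dia n a \<phi>)" "forces x (dia m (b \<oplus> \<one>) \<psi>)"
  shows "forces x (dia n a (Conj \<phi> (dia m (b \<oplus> \<one>) \<psi>)))"
proof (cases "a = \<zero>")
  case False
  define v where "v = step m (b \<oplus> \<one>) w"
  have v: "cone (dia m (b \<oplus> \<one>) \<psi>) v" unfolding v_def using \<psi> by (rule cone_dia) simp
  have yx: "reach n a y x" using assms False forces_dia_iff[OF \<phi> x] by blast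
  have wx: "reach m (b \<oplus> \<one>) w x" using assms forces_dia_iff[OF \<psi> x, of "b \<oplus> \<one>" m] by simp
  have ylt: "y i < x i" if "i \<le> n" for i using reach_less[OF yx False that] .
  have vlt: "v i < x i" if "i \<le> m" for i
    unfolding v_def
  proof (rule step_less[OF x _ _ that])
    let ?q = "w (Suc m)" and ?c = "w m \<oplus> oexpw (w (Suc m)) \<odot> b"
    \<comment> \<open>As m < n, the step at level n is already strict at level m + 1.\<close>
    have "?q \<le> y (Suc m)" using wy by (rule le_funD)
    also have "\<dots> < x (Suc m)" using \<open>m < n\<close> by (intro ylt) simp
    finally have q: "?q < x (Suc m)" .
    have "?c \<oplus> \<zero> < ?c \<oplus> oexpw ?q" by (subst oadd_less_iff) (simp add: ozero_less_iff)
    also have "\<dots> \<le> x m" using wx unfolding reach_def by (simp add: oadd_omul oadd_assoc)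
    finally have "?c < x m" by simp
    \<comment> \<open>Thus \<open>x m\<close> is a limit of multiples of omega^\<open>?q\<close>, so
      the last block added by the successor exponent ends strictly below it.\<close>
    with Hset_omult[OF x] q obtain u where u: "?c < u" "u < x m" "omult ?q u" by (rule omult_limit)
    then have "?c \<oplus> oexpw ?q < x m" using oadd_oexpw_le order_le_less_trans by blast
    then show "w m \<oplus> oexpw ?q \<odot> (b \<oplus> \<one>) < x m" by (simp add: oadd_omul oadd_assoc)
  qed (use wx in \<open>simp add: reach_def\<close>)
  let ?z = "join (Suc m) y v"
  have z: "?z \<in> Hset" using \<phi> by (intro join_in_Hset) (simp add: cone_def)
  \<comment> \<open>Above m, v copies w, so the join leaves the entries of y there
    unchanged.\<close>
  have "v i \<le> y i" if "Suc m \<le> i" for i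
    using that wy unfolding v_def by (simp add: le_funD)
  then have "y \<le> ?z \<and> v \<le> ?z" using join_le_iff[OF z, of "Suc m" v y] by simp
  then have "forces ?z (Conj \<phi> (dia m (b \<oplus> \<one>) \<psi>))" using \<phi> v z by (simp add: cone_def)
  moreover have "reach n a ?z x"
  proof -
    have same: "?z i = y i" if "m < i" for i
      using that by (simp add: join_def fill_same)
    have "?z i < x i" if "i < n" for i
    proof (cases "i \<le> m")
      case True
      then show ?thesis unfolding join_def
        using ylt vlt \<open>m < n\<close> by (intro fill_less[OF x]) auto
    qed (use ylt same that in simp)
    then show ?thesis using yx \<open>m < n\<close> unfolding reach_def by (simp add: same)
  qed
  ultimately show ?thesis using Srel_pow_iff[OF x z False] z unfolding forces_dia[OF x] by blast
qed (use assms in simp)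

lemma soundness:
  assumes "\<phi> \<turnstile>\<^sub>T \<psi>" "x \<in> Hset" "forces x \<phi>"
  shows "forces (x :: nat \<Rightarrow> 'o) \<psi>"
  using assms
proof (induction arbitrary: x rule: tsc.induct)
  case (ax_mono \<phi> \<beta> \<alpha> n)
  obtain m where m: "cone \<phi> m" using ax_mono ex_cones by blast
  have "\<alpha> \<noteq> \<zero>" using ax_mono by auto
  then have "reach n \<alpha> m x" using ax_mono forces_dia_iff[OF m] by simp
  then have "reach n \<beta> m x" "m \<le> x" using ax_mono reach_mono_exponent reach_le by (auto simp: less_imp_le)
  then show ?case using m ax_mono.prems forces_dia_iff[OF m]
    by (cases "\<beta> = \<zero>") (auto simp: cone_def)
next
  case (ax_add1 \<phi> n \<beta> \<alpha>)
  then show ?case using forces_dia_dia by simp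
next
  case (ax_add2 \<phi> n \<alpha> \<beta>)
  then show ?case using forces_dia_dia by simp
next
  case (ax_red \<phi> n m \<alpha>)
  obtain y where y: "cone \<phi> y" using ax_red ex_cones by blast
  then show ?case using ax_red.prems forces_dia_iff[OF y] reach_hexpn
    by (cases "\<alpha> = \<zero>") auto
next
  case (ax_mnf1 n0 \<alpha>0 xs n \<alpha>)
  then show ?case using forces_mnf by blast
next
  case (ax_mnf2 n0 \<alpha>0 xs n \<alpha>)
  then show ?case using forces_mnf by blast
next
  case (r_nec \<phi> \<psi> n \<alpha>)
  then show ?case using forces_dia[OF r_nec.prems(1)] by metis
next
  case (r_mix \<phi> \<psi> m n \<alpha> \<beta>)
  obtain y w where y: "cone \<phi> y" and w: "cone \<psi> w"
    using tsc_wff[OF r_mix.hyps(1)] ex_cones by blast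
  \<comment> \<open>Applying the induction hypothesis at the least point of \<phi> compares the two
    least points.\<close>
  then have "w \<le> y" using r_mix.IH[of y] y by (simp add: cone_def)
  then show ?case using r_mix.prems forces_mix[OF y w _ \<open>m < n\<close>] by simp
qed (auto)

lemma completeness:
  assumes "wff \<phi>" "wff \<psi>" "\<And>x :: nat \<Rightarrow> 'o. x \<in> Hset \<Longrightarrow> forces x \<phi> \<Longrightarrow> forces x \<psi>"
  shows "\<phi> \<turnstile>\<^sub>T \<psi>"
proof -
  obtain a b where ab: "cone \<phi> a" "tsc_cone \<phi> a" "cone \<psi> b" "tsc_cone \<psi> b"
    using assms ex_cones by metis
  then have "b \<le> a" using assms(3)[of a] by (simp add: cone_def)
  moreover have "\<phi> \<turnstile>\<^sub>T dia i (a i) Top" for i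
    using ab assms(1) ax_refl unfolding tsc_cone_def by blast
  ultimately have "\<phi> \<turnstile>\<^sub>T dia i (b i) Top" for i
    using tsc_atom_le le_funD by metis
  then show ?thesis using ab assms(1) unfolding tsc_cone_def by blast
qed

end

theorem theorem5p2:
  fixes \<phi> \<psi> :: "'o::wellorder fml"
  assumes "countable (UNIV :: 'o set)"
    and "epsilon_number_type TYPE('o)"
    and "wff \<phi>" and "wff \<psi>"
  shows "\<phi> \<turnstile>\<^sub>T \<psi> \<longleftrightarrow> (\<forall>x\<in>Hset. forces x \<phi> \<longrightarrow> forces x \<psi>)"
proof -
  interpret epsilon_number "TYPE('o)" by unfold_locales (rule assms(2))
  show ?thesis using soundness completeness assms(3,4) by blast
qed

end
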